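(* Let $n\ge 2$. (i) Let $m\ge 1$ and let $(j_s,i_s)_{1\le s\le m}$ be any family of integers satisfying the pairwise inequalities. Then the expression $$w=\mathcal B(j_1,i_1)\,\mathcal B(j_2,i_2)\cdots \mathcal B(j_m,i_m)$$ is reduced and affine length reduced, and satisfies $\mathscr R(w)=\{a_{n+1}\}$. (ii) Let $m\ge 1$. Any $w\in W(\tilde A_n)$ with $L(w)=m$ can be written uniquely as $$w=\mathcal B(j_1,i_1)\,\mathcal B(j_2,i_2)\cdots \mathcal B(j_m,i_m)\,x,$$ where $(j_s,i_s)_{1\le s\le m}$ satisfies the pairwise inequalities and $x$ is the canonical reduced expression of an element of $W(A_n)$. Such a form is reduced: $$l(w)=l(x)+\sum_{s=1}^m (n+1+i_s+1-j_s).$$ Specifically, a canonical reduced expression for $w$ is given by $$w=\mathcal B(j_1,i_1)\cdots\mathcal B(j_m,i_m)\,\lfloor k_1,l_1\rfloor\lfloor k_2,l_2\rfloor\cdots\lfloor k_t,l_t\rfloor$$ with $t\ge 0$, $n\ge l_1>\dots>l_t\ge 1$ and $l_h\ge k_h\ge 1$ for $1\le h\le t$.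
   Context: $W(\tilde A_n)$ ($n\ge 2$) is the affine Coxeter group of type $\tilde A_n$ with generators $S_n=\{\sigma_1,\dots,\sigma_n,a_{n+1}\}$ whose Coxeter diagram is the $(n+1)$-cycle $\sigma_1-\sigma_2-\cdots-\sigma_n-a_{n+1}-\sigma_1$ (all edges of order 3). $W(A_n)$ is the parabolic subgroup generated by $\sigma_1,\dots,\sigma_n$. $l$ is the Coxeter length, and $\mathscr R(w)=\{s\in S_n : l(ws)<l(w)\}$. The affine length $L(w)$ is the minimal number of occurrences of $a_{n+1}$ in the reduced expressions of $w$; an affine length reduced expression of $w$ is a reduced expression of $w$ with exactly $L(w)$ occurrences of $a_{n+1}$. Notation: $\lfloor i,j\rfloor=\sigma_i\sigma_{i+1}\cdots\sigma_j$ for $1\le i\le j\le n$, and $\lfloor n+1,n\rfloor=1$; $\lceil i,j\rceil=\sigma_i\sigma_{i-1}\cdots\sigma_j$ for $1\le j\le i\le n$, and $\lceil 0,1\rceil=1$; $h(r,i)=\lfloor r,n\rfloor\lceil i,1\rceil$ and $\mathcal B(r,i)=h(r,i)\,a_{n+1}$ (affine brick) for $0\le i\le n-1$, $1\le r\le n+1$. The canonical reduced expression of an element of $W(A_n)$ is its unique expression of the form $\lfloor k_1,l_1\rfloor\cdots\lfloor k_t,l_t\rfloor$ with $t\ge0$, $n\ge l_1>\dots>l_t\ge1$ and $l_h\ge k_h\ge1$ (it is reduced; $t=0$ gives the identity). Pairwise inequalities: a family of integers $(j_s,i_s)_{1\le s\le m}$ satisfies the pairwise inequalities if: (1) $1\le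 j_1\le n+1$ and $0\le i_1\le n-1$; (2) for $2\le s\le m$, either $i_s=0$ and $j_s=1$, or $1\le i_s\le n-1$ and $1\le j_s\le n$; (3) for $2\le s\le m$, $j_s\le j_{s-1}$ and $i_s\ge i_{s-1}$; (4) for $2\le s\le m$, if $j_{s-1}>i_{s-1}+1$ then $j_s<j_{s-1}$; (5) for $2\le s\le m$, if $j_s>i_s+1$ then $i_s>i_{s-1}$. *)

theory Defs
  imports "HOL-Algebra.Generated_Groups"
begin

section \<open>Coxeter groups by generators and relations\<close>

text \<open>
  Elements of the Coxeter group of a matrix \<open>M\<close> over an alphabet \<open>S\<close> are classes of words
  over \<open>S\<close>, modulo the congruence generated by the relators \<open>(s t)\<^bsup>M s t\<^esup> = 1\<close>.  Formal inverse
  letters are not needed: the relator for \<open>s = t\<close> and \<open>M s s = 1\<close> is \<open>s s = 1\<close>.  The entry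
  \<open>M s t = 0\<close> imposes no relation, that is, it encodes an infinite order.
\<close>

inductive cox_eq :: "'a set \<Rightarrow> ('a \<Rightarrow> 'a \<Rightarrow> nat) \<Rightarrow> 'a list \<Rightarrow> 'a list \<Rightarrow> bool"
  for S :: "'a set" and M :: "'a \<Rightarrow> 'a \<Rightarrow> nat" where
  relator: "\<lbrakk>s \<in> S; t \<in> S\<rbrakk> \<Longrightarrow> cox_eq S M (concat (replicate (M s t) [s, t])) []"
| refl: "u \<in> lists S \<Longrightarrow> cox_eq S M u u"
| sym: "cox_eq S M u v \<Longrightarrow> cox_eq S M v u"
| trans: "\<lbrakk>cox_eq S M u v; cox_eq S M v w\<rbrakk> \<Longrightarrow> cox_eq S M u w"
| mult: "\<lbrakk>cox_eq S M u v; cox_eq S M u' v'\<rbrakk> \<Longrightarrow> cox_eq S M (u @ u') (v @ v')"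

definition cox_rel :: "'a set \<Rightarrow> ('a \<Rightarrow> 'a \<Rightarrow> nat) \<Rightarrow> ('a list \<times> 'a list) set" where
  "cox_rel S M = {(u, v). cox_eq S M u v}"

definition cox_elt :: "'a set \<Rightarrow> ('a \<Rightarrow> 'a \<Rightarrow> nat) \<Rightarrow> 'a list \<Rightarrow> 'a list set" where
  "cox_elt S M u = cox_rel S M `` {u}"

definition coxeter_group :: "'a set \<Rightarrow> ('a \<Rightarrow> 'a \<Rightarrow> nat) \<Rightarrow> 'a list set monoid" where
  "coxeter_group S M =
    \<lparr>carrier = lists S // cox_rel S M,
     mult = (\<lambda>A B. \<Union>u\<in>A. \<Union>v\<in>B. cox_elt S M (u @ v)),
     one = cox_elt S M []\<rparr>"

definition cox_length :: "'a set \<Rightarrow> ('a \<Rightarrow> 'a \<Rightarrow> nat) \<Rightarrow> 'a list set \<Rightarrow> nat" where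
  "cox_length S M w = (LEAST k. \<exists>u \<in> lists S. cox_elt S M u = w \<and> length u = k)"

definition reduced_expression ::
    "'a set \<Rightarrow> ('a \<Rightarrow> 'a \<Rightarrow> nat) \<Rightarrow> 'a list \<Rightarrow> 'a list set \<Rightarrow> bool" where
  "reduced_expression S M u w \<longleftrightarrow>
     u \<in> lists S \<and> cox_elt S M u = w \<and> length u = cox_length S M w"

definition right_descents :: "'a set \<Rightarrow> ('a \<Rightarrow> 'a \<Rightarrow> nat) \<Rightarrow> 'a list set \<Rightarrow> 'a set" where
  "right_descents S M w =
     {s \<in> S. cox_length S M (w \<otimes>\<^bsub>coxeter_group S M\<^esub> cox_elt S M [s]) < cox_length S M w}"

lemma cox_eq_lists: "cox_eq S M u v \<Longrightarrow> u \<in> lists S \<and> v \<in> lists S"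
  by (induction rule: cox_eq.induct) (auto split: if_splits)

lemma equiv_cox_rel: "equiv (lists S) (cox_rel S M)"
proof (rule equivI)
  show "cox_rel S M \<subseteq> lists S \<times> lists S"
    using cox_eq_lists by (fastforce simp: cox_rel_def)
  show "refl_on (lists S) (cox_rel S M)"
    by (auto simp: refl_on_def cox_rel_def intro: cox_eq.refl)
  show "sym (cox_rel S M)"
    by (auto simp: sym_def cox_rel_def intro: cox_eq.sym)
  show "trans (cox_rel S M)"
    unfolding trans_def cox_rel_def by (auto intro: cox_eq.trans)
qed

lemma cox_elt_eq_iff:
  assumes "u \<in> lists S" "v \<in> lists S"
  shows "cox_elt S M u = cox_elt S M v \<longleftrightarrow> cox_eq S M u v"
  using eq_equiv_class_iff[OF equiv_cox_rel assms] by (simp add: cox_elt_def cox_rel_def)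

lemma carrier_coxeter_group: "carrier (coxeter_group S M) = cox_elt S M ` lists S"
  by (auto simp: coxeter_group_def quotient_def cox_elt_def)

lemma mult_cox_elt:
  assumes "u \<in> lists S" "v \<in> lists S"
  shows "cox_elt S M u \<otimes>\<^bsub>coxeter_group S M\<^esub> cox_elt S M v = cox_elt S M (u @ v)"
proof -
  have *: "cox_elt S M (u' @ v') = cox_elt S M (u @ v)"
    if "u' \<in> cox_elt S M u" "v' \<in> cox_elt S M v" for u' v'
  proof -
    have e: "cox_eq S M u u'" "cox_eq S M v v'"
      using that by (auto simp: cox_elt_def cox_rel_def)
    then have "cox_eq S M (u' @ v') (u @ v)"
      by (metis cox_eq.mult cox_eq.sym)
    with cox_eq_lists[OF this] show ?thesis by (simp add: cox_elt_eq_iff)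
  qed
  have "u \<in> cox_elt S M u" "v \<in> cox_elt S M v"
    using assms by (auto simp: cox_elt_def cox_rel_def intro: cox_eq.refl)
  then have ne: "cox_elt S M u \<noteq> {}" "cox_elt S M v \<noteq> {}"
    by blast+
  have "(\<Union>u'\<in>cox_elt S M u. \<Union>v'\<in>cox_elt S M v. cox_elt S M (u' @ v')) =
      (\<Union>u'\<in>cox_elt S M u. \<Union>v'\<in>cox_elt S M v. cox_elt S M (u @ v))"
    by (intro SUP_cong HOL.refl *)
  also have "\<dots> = cox_elt S M (u @ v)"
    unfolding SUP_constant using ne by (simp only: if_False)
  finally show ?thesis by (simp add: coxeter_group_def)
qed

lemma one_coxeter_group: "\<one>\<^bsub>coxeter_group S M\<^esub> = cox_elt S M []"
  by (simp add: coxeter_group_def)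

lemma cox_eq_rev:
  assumes "\<And>s. s \<in> S \<Longrightarrow> M s s = 1" "u \<in> lists S"
  shows "cox_eq S M (rev u @ u) []"
  using assms(2)
proof (induction u)
  case Nil
  then show ?case by (auto intro: cox_eq.refl)
next
  case (Cons s u)
  have u: "u \<in> lists S" and s: "s \<in> S" using Cons by auto
  have "cox_eq S M [s, s] []"
    using cox_eq.relator[OF s s, of M] assms(1)[OF s] by simp
  then have "cox_eq S M (rev u @ [s, s] @ u) (rev u @ [] @ u)"
    using u by (intro cox_eq.mult) (auto intro!: cox_eq.refl)
  then have "cox_eq S M (rev (s # u) @ s # u) (rev u @ u)" by simp
  then show ?case using Cons.IH by (rule cox_eq.trans)
qed

lemma group_coxeter_group:
  assumes "\<And>s. s \<in> S \<Longrightarrow> M s s = 1"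
  shows "group (coxeter_group S M)"
proof (rule groupI)
  fix x y assume "x \<in> carrier (coxeter_group S M)" "y \<in> carrier (coxeter_group S M)"
  then obtain u v where "u \<in> lists S" "x = cox_elt S M u" "v \<in> lists S" "y = cox_elt S M v"
    by (auto simp: carrier_coxeter_group)
  then show "x \<otimes>\<^bsub>coxeter_group S M\<^esub> y \<in> carrier (coxeter_group S M)"
    unfolding carrier_coxeter_group by (metis mult_cox_elt imageI append_in_lists_conv)
next
  show "\<one>\<^bsub>coxeter_group S M\<^esub> \<in> carrier (coxeter_group S M)"
    unfolding carrier_coxeter_group one_coxeter_group by (rule imageI) simp
next
  fix x y z
  assume "x \<in> carrier (coxeter_group S M)" "y \<in> carrier (coxeter_group S M)"
    "z \<in> carrier (coxeter_group S M)"
  then obtain u v w where "u \<in> lists S" "x = cox_elt S M u" "v \<in> lists S" "y = cox_elt S M v"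
    "w \<in> lists S" "z = cox_elt S M w"
    unfolding carrier_coxeter_group by blast
  then show "x \<otimes>\<^bsub>coxeter_group S M\<^esub> y \<otimes>\<^bsub>coxeter_group S M\<^esub> z =
      x \<otimes>\<^bsub>coxeter_group S M\<^esub> (y \<otimes>\<^bsub>coxeter_group S M\<^esub> z)"
    by (metis mult_cox_elt append_in_lists_conv append_assoc)
next
  fix x assume "x \<in> carrier (coxeter_group S M)"
  then obtain u where "u \<in> lists S" "x = cox_elt S M u"
    unfolding carrier_coxeter_group by blast
  then show "\<one>\<^bsub>coxeter_group S M\<^esub> \<otimes>\<^bsub>coxeter_group S M\<^esub> x = x"
    unfolding one_coxeter_group by (metis mult_cox_elt append_Nil lists.Nil)
next
  fix x assume "x \<in> carrier (coxeter_group S M)"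
  then obtain u where u: "u \<in> lists S" "x = cox_elt S M u"
    unfolding carrier_coxeter_group by blast
  then have r: "rev u \<in> lists S" by (simp add: in_lists_conv_set)
  have "cox_elt S M (rev u @ u) = cox_elt S M []"
    using cox_eq_rev[of S M u] assms u(1) r
    by (subst cox_elt_eq_iff) (simp_all only: append_in_lists_conv lists.Nil simp_thms)
  then have "cox_elt S M (rev u) \<otimes>\<^bsub>coxeter_group S M\<^esub> x = \<one>\<^bsub>coxeter_group S M\<^esub>"
    unfolding one_coxeter_group u(2) mult_cox_elt[OF r u(1)] .
  then show "\<exists>y\<in>carrier (coxeter_group S M). y \<otimes>\<^bsub>coxeter_group S M\<^esub> x = \<one>\<^bsub>coxeter_group S M\<^esub>"
    using r unfolding carrier_coxeter_group by blast
qed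


section \<open>The affine Coxeter group of type \<open>A\<close>\<close>

text \<open>The letter \<open>i\<close> with \<open>1 \<le> i \<le> n\<close> stands for \<open>\<sigma>\<^sub>i\<close>, and the letter \<open>n + 1\<close> for \<open>a\<^bsub>n+1\<^esub>\<close>.\<close>

definition affA_gens :: "nat \<Rightarrow> nat set" where
  "affA_gens n = {1..n + 1}"

definition affA_adjacent :: "nat \<Rightarrow> nat \<Rightarrow> nat \<Rightarrow> bool" where
  "affA_adjacent n s t \<longleftrightarrow> t = s + 1 \<or> s = t + 1 \<or> {s, t} = {1, n + 1}"

definition affA_matrix :: "nat \<Rightarrow> nat \<Rightarrow> nat \<Rightarrow> nat" where
  "affA_matrix n s t = (if s = t then 1 else if affA_adjacent n s t then 3 else 2)"

definition affA :: "nat \<Rightarrow> nat list set monoid" where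
  "affA n = coxeter_group (affA_gens n) (affA_matrix n)"

definition affA_elt :: "nat \<Rightarrow> nat list \<Rightarrow> nat list set" where
  "affA_elt n u = cox_elt (affA_gens n) (affA_matrix n) u"

definition affA_length :: "nat \<Rightarrow> nat list set \<Rightarrow> nat" where
  "affA_length n w = cox_length (affA_gens n) (affA_matrix n) w"

definition affA_reduced :: "nat \<Rightarrow> nat list \<Rightarrow> nat list set \<Rightarrow> bool" where
  "affA_reduced n u w \<longleftrightarrow> reduced_expression (affA_gens n) (affA_matrix n) u w"

definition affA_right_descents :: "nat \<Rightarrow> nat list set \<Rightarrow> nat set" where
  "affA_right_descents n w = right_descents (affA_gens n) (affA_matrix n) w"

lemma group_affA: "group (affA n)"
  unfolding affA_def by (rule group_coxeter_group) (simp add: affA_matrix_def)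

definition finA :: "nat \<Rightarrow> nat list set set" where
  "finA n = generate (affA n) ((\<lambda>i. affA_elt n [i]) ` {1..n})"

definition affine_length :: "nat \<Rightarrow> nat list set \<Rightarrow> nat" where
  "affine_length n w = (LEAST k. \<exists>u. affA_reduced n u w \<and> count_list u (n + 1) = k)"

definition affine_length_reduced :: "nat \<Rightarrow> nat list \<Rightarrow> nat list set \<Rightarrow> bool" where
  "affine_length_reduced n u w \<longleftrightarrow>
     affA_reduced n u w \<and> count_list u (n + 1) = affine_length n w"


section \<open>Bricks and canonical expressions\<close>

text \<open>The conventions \<open>\<lfloor>n+1,n\<rfloor> = 1\<close> and \<open>\<lceil>0,1\<rceil> = 1\<close> are instances of the formulas below.\<close>

definition asc :: "nat \<Rightarrow> nat \<Rightarrow> nat list" where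
  "asc i j = [i..<j + 1]"

definition desc :: "nat \<Rightarrow> nat \<Rightarrow> nat list" where
  "desc i j = rev [j..<i + 1]"

definition h_word :: "nat \<Rightarrow> nat \<Rightarrow> nat \<Rightarrow> nat list" where
  "h_word n r i = asc r n @ desc i 1"

definition brick :: "nat \<Rightarrow> nat \<Rightarrow> nat \<Rightarrow> nat list" where
  "brick n r i = h_word n r i @ [n + 1]"

text \<open>
  A family \<open>(j\<^sub>s, i\<^sub>s)\<close>, \<open>1 \<le> s \<le> m\<close>, is the list of its pairs; positions in the list count from 0.
\<close>

definition brick_word :: "nat \<Rightarrow> (nat \<times> nat) list \<Rightarrow> nat list" where
  "brick_word n js = concat (map (\<lambda>(j, i). brick n j i) js)"

definition pairwise_ineqs :: "nat \<Rightarrow> (nat \<times> nat) list \<Rightarrow> bool" where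
  "pairwise_ineqs n js \<longleftrightarrow>
     (let j = (\<lambda>s. fst (js ! s)); i = (\<lambda>s. snd (js ! s)) in
      (js \<noteq> [] \<longrightarrow> 1 \<le> j 0 \<and> j 0 \<le> n + 1 \<and> i 0 \<le> n - 1) \<and>
      (\<forall>s. 1 \<le> s \<and> s < length js \<longrightarrow>
         (i s = 0 \<and> j s = 1 \<or> 1 \<le> i s \<and> i s \<le> n - 1 \<and> 1 \<le> j s \<and> j s \<le> n) \<and>
         j s \<le> j (s - 1) \<and> i s \<ge> i (s - 1) \<and>
         (j (s - 1) > i (s - 1) + 1 \<longrightarrow> j s < j (s - 1)) \<and>
         (j s > i s + 1 \<longrightarrow> i s > i (s - 1))))"

definition canonical_params :: "nat \<Rightarrow> (nat \<times> nat) list \<Rightarrow> bool" where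
  "canonical_params n kl \<longleftrightarrow>
     sorted_wrt (>) (map snd kl) \<and> (\<forall>(k, l) \<in> set kl. 1 \<le> k \<and> k \<le> l \<and> l \<le> n)"

definition canonical_word :: "(nat \<times> nat) list \<Rightarrow> nat list" where
  "canonical_word kl = concat (map (\<lambda>(k, l). asc k l) kl)"

definition is_canonical_expression :: "nat \<Rightarrow> nat list \<Rightarrow> nat list set \<Rightarrow> bool" where
  "is_canonical_expression n x y \<longleftrightarrow>
     affA_elt n x = y \<and> (\<exists>kl. canonical_params n kl \<and> x = canonical_word kl)"

definition affine_form ::
    "nat \<Rightarrow> nat \<Rightarrow> nat list set \<Rightarrow> (nat \<times> nat) list \<Rightarrow> nat list \<Rightarrow> bool" where
  "affine_form n m w js x \<longleftrightarrow>
     length js = m \<and> pairwise_ineqs n js \<and>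
     (\<exists>y \<in> finA n. is_canonical_expression n x y) \<and>
     w = affA_elt n (brick_word n js @ x)"

end

theory Submission
  imports Defs
begin

text \<open>
  Let the group act on integer vectors \<open>(z\<^sub>1, \<dots>, z\<^bsub>n+1\<^esub>)\<close>: the letter \<open>\<sigma>\<^sub>i\<close> exchanges two neighbouring
  entries, and \<open>a\<^bsub>n+1\<^esub>\<close> replaces \<open>(z\<^sub>1, z\<^bsub>n+1\<^esub>)\<close> by \<open>(z\<^bsub>n+1\<^esub> + K, z\<^sub>1 - K)\<close>.  This respects the
  relations for every period \<open>K\<close>, and two periods are used.

  For \<open>K = n + 1\<close>, starting from \<open>(n, \<dots>, 1, 0)\<close>, the vectors are windows of affine permutations.
  The differences of neighbouring entries (with a correction by \<open>K\<close> for the pair at the ends) change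
  under a letter like simple roots under a simple reflection, and they never vanish, because the
  entries keep distinct residues modulo \<open>n + 1\<close>.  An induction over dihedral subgroups gives the
  exchange property (\<open>descent_exchange\<close>), and with it the solution of the word problem: words are
  equal in the group exactly if they lead to the same window, and a word is reduced if each of its
  letters, read from the right, is applied where its difference is positive.

  For \<open>K = 1\<close>, starting from the origin, \<open>W(A\<^sub>n)\<close> fixes the origin, and the vector reached by \<open>w\<close>
  describes the coset \<open>w W(A\<^sub>n)\<close>.  It is the entrywise quotient by \<open>n + 1\<close> of the window of \<open>w\<close>, and
  a letter with positive difference for \<open>K = 1\<close> has one for \<open>K = n + 1\<close>.  On such a vector \<open>c\<close> the
  brick \<open>\<B>(j,i)\<close> acts as follows: the last entry is increased by one and moved to the front, the
  first is decreased by one and moved to the end; then the former is carried over \<open>i\<close> places to the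
  right, and finally the latter is carried to the left to position \<open>j\<close>.  The pairwise inequalities
  say precisely that, whenever a brick has acted, the entry just increased is the leftmost
  positive entry and the entry just decreased is the rightmost negative entry (\<open>fits_brick\<close>,
  \<open>fits_iff\<close>).  Hence the first brick can be read off from the vector, which gives uniqueness, and
  removing it lowers the sum of the positive entries by one, which gives existence.  The
  comparisons made while an entry is carried are between a positive and a nonpositive entry, or a
  nonnegative and a negative one, so every step goes up in length.

  The same sum of positive entries is the affine length: the letters \<open>\<sigma>\<^sub>i\<close> preserve it, a letter
  \<open>a\<^bsub>n+1\<^esub>\<close> increases it by at most one, and each brick of a normal form increases it by exactly one.
  Finally, the canonical expression of an element of \<open>W(A\<^sub>n)\<close> is insertion sort: \<open>\<lfloor>k,l\<rfloor>\<close> carries the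
  entry at position \<open>l + 1\<close>, so far untouched and smaller than everything to its left, to
  position \<open>k\<close>.
\<close>

section \<open>Words acting on integer vectors\<close>

text \<open>
  The letter \<open>s\<close> exchanges the entries at \<open>s\<close> and at the next position of the cycle \<open>1, \<dots>, n + 1\<close>.
  Reading the vector as one period of a sequence with \<open>z (k + n + 1) = z k - K\<close>, the letter \<open>n + 1\<close>
  is an exchange of neighbours as well; \<open>wrap\<close> is the shift due to passing to the next period.
  This makes the \<open>n + 1\<close> letters alike, so that few case distinctions are needed.
\<close>
definition succ_gen :: "nat \<Rightarrow> nat \<Rightarrow> nat" where
  "succ_gen n s = (if s = n + 1 then 1 else s + 1)"

definition wrap :: "nat \<Rightarrow> int \<Rightarrow> nat \<Rightarrow> int" where
  "wrap n K s = (if s = n + 1 then K else 0)"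

definition act :: "nat \<Rightarrow> int \<Rightarrow> nat \<Rightarrow> (nat \<Rightarrow> int) \<Rightarrow> nat \<Rightarrow> int" where
  "act n K s z = z(s := z (succ_gen n s) - wrap n K s, succ_gen n s := z s + wrap n K s)"

text \<open>
  The value of the simple root of \<open>s\<close> at \<open>z\<close>; its sign tells whether \<open>s\<close> goes up or down in length.
\<close>
definition height :: "nat \<Rightarrow> int \<Rightarrow> nat \<Rightarrow> (nat \<Rightarrow> int) \<Rightarrow> int" where
  "height n K s z = z s - z (succ_gen n s) + wrap n K s"

abbreviation run :: "nat \<Rightarrow> int \<Rightarrow> nat list \<Rightarrow> (nat \<Rightarrow> int) \<Rightarrow> nat \<Rightarrow> int" where
  "run n K u z \<equiv> foldr (act n K) u z"

text \<open>
  Each letter, from the last one to the first, goes up.  For the period \<open>n + 1\<close> and the start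
  \<open>base n\<close> these words turn out to be reduced.
\<close>
fun ascending :: "nat \<Rightarrow> int \<Rightarrow> nat list \<Rightarrow> (nat \<Rightarrow> int) \<Rightarrow> bool" where
  "ascending n K [] z \<longleftrightarrow> True"
| "ascending n K (s # u) z \<longleftrightarrow> ascending n K u z \<and> 0 < height n K s (run n K u z)"

lemma ascending_append:
  "ascending n K (u @ v) z \<longleftrightarrow> ascending n K v z \<and> ascending n K u (run n K v z)"
  by (induction u) auto

text \<open>
  The value 0 off the window makes the entrywise quotient by \<open>n + 1\<close> the zero function.
\<close>
definition base :: "nat \<Rightarrow> nat \<Rightarrow> int" where
  "base n k = (if k \<in> {1..n + 1} then int n + 1 - int k else 0)"

text \<open>
  Words have no inverse letters; as generators are involutions, reversal inverts a word.
\<close>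
lemma cox_eq_of_relator:
  assumes "\<And>s. s \<in> S \<Longrightarrow> M s s = 1" "cox_eq S M (u @ v) []"
  shows "cox_eq S M u (rev v)"
proof -
  have l: "u \<in> lists S" "v \<in> lists S" "rev v \<in> lists S"
    using cox_eq_lists[OF assms(2)] by (auto simp: in_lists_conv_set)
  have "cox_eq S M (v @ rev v) []"
    using cox_eq_rev[of S M "rev v", OF assms(1) l(3)] by simp
  then have "cox_eq S M (u @ v @ rev v) (u @ [])"
    using l by (intro cox_eq.mult cox_eq.refl)
  moreover have "cox_eq S M ((u @ v) @ rev v) ([] @ rev v)"
    using l by (intro cox_eq.mult assms(2) cox_eq.refl)
  ultimately show ?thesis
    by (metis append.assoc append_Nil append_Nil2 cox_eq.sym cox_eq.trans)
qed

locale affine_A =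
  fixes n :: nat
  assumes n2: "2 \<le> n"
begin

abbreviation word_eq :: "nat list \<Rightarrow> nat list \<Rightarrow> bool" (infix "\<approx>" 50) where
  "u \<approx> v \<equiv> cox_eq (affA_gens n) (affA_matrix n) u v"

abbreviation gens :: "nat set" where "gens \<equiv> affA_gens n"

abbreviation nx :: "nat \<Rightarrow> nat" where "nx \<equiv> succ_gen n"

lemma nx_gen: "s \<in> gens \<Longrightarrow> nx s \<in> gens"
  by (auto simp: affA_gens_def succ_gen_def)

lemma nx_neq: "s \<in> gens \<Longrightarrow> nx s \<noteq> s"
  using n2 by (auto simp: affA_gens_def succ_gen_def)

lemma nx_nx_neq: "s \<in> gens \<Longrightarrow> nx (nx s) \<noteq> s"
  using n2 by (simp add: affA_gens_def succ_gen_def)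

lemma nx_inj: "\<lbrakk>s \<in> gens; t \<in> gens\<rbrakk> \<Longrightarrow> nx s = nx t \<longleftrightarrow> s = t"
  by (auto simp: affA_gens_def succ_gen_def)

lemma adjacent_iff:
  assumes "s \<in> gens" "t \<in> gens"
  shows "affA_adjacent n s t \<longleftrightarrow> t = nx s \<or> s = nx t"
proof -
  have "s \<le> n + 1" "t \<le> n + 1" "1 \<le> s" "1 \<le> t" using assms by (simp_all add: affA_gens_def)
  then show ?thesis
    unfolding affA_adjacent_def succ_gen_def doubleton_eq_iff using n2 by (simp split: if_split) arith
qed

text \<open>
  The next three facts are the action of a simple reflection on the simple roots of a simply laced
  diagram.  The exchange property rests on them.
\<close>
lemma height_act_self: "s \<in> gens \<Longrightarrow> height n K s (act n K s z) = - height n K s z"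
  using nx_neq[of s] by (auto simp: height_def act_def)

lemma height_act_adjacent:
  "\<lbrakk>s \<in> gens; t \<in> gens; affA_adjacent n s t\<rbrakk> \<Longrightarrow>
     height n K t (act n K s z) = height n K s z + height n K t z"
  using nx_neq[of s] nx_nx_neq[of s] nx_neq[of t] nx_nx_neq[of t] by (auto simp: adjacent_iff height_def act_def)

lemma height_act_far:
  "\<lbrakk>s \<in> gens; t \<in> gens; \<not> affA_adjacent n s t; s \<noteq> t\<rbrakk> \<Longrightarrow>
     height n K t (act n K s z) = height n K t z"
  using nx_inj[of s t] by (auto simp: adjacent_iff height_def act_def)

lemma act_act: "s \<in> gens \<Longrightarrow> act n K s (act n K s z) = z"
  using nx_neq[of s] by (auto simp: act_def fun_eq_iff)

lemma act_braid_nx: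
  "s \<in> gens \<Longrightarrow> act n K s (act n K (nx s) (act n K s z)) = act n K (nx s) (act n K s (act n K (nx s) z))"
  using nx_neq[of s] nx_nx_neq[of s] nx_neq[of "nx s"] nx_gen[of s] by (auto simp: act_def fun_eq_iff)

lemma act_braid:
  "\<lbrakk>s \<in> gens; t \<in> gens; affA_adjacent n s t\<rbrakk> \<Longrightarrow>
     act n K s (act n K t (act n K s z)) = act n K t (act n K s (act n K t z))"
  using act_braid_nx by (auto simp: adjacent_iff)

lemma act_commute:
  "\<lbrakk>s \<in> gens; t \<in> gens; \<not> affA_adjacent n s t; s \<noteq> t\<rbrakk> \<Longrightarrow>
     act n K s (act n K t z) = act n K t (act n K s z)"
  using nx_inj[of s t] by (auto simp: adjacent_iff act_def fun_eq_iff)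

lemma run_cong: "u \<approx> v \<Longrightarrow> run n K u z = run n K v z"
proof (induction arbitrary: z rule: cox_eq.induct)
  case (relator s t)
  have r: "replicate 3 [s, t] = [[s, t], [s, t], [s, t]]" "replicate 2 [s, t] = [[s, t], [s, t]]"
    by (simp_all add: numeral_eq_Suc)
  consider "s = t" | "s \<noteq> t" "affA_adjacent n s t" | "s \<noteq> t" "\<not> affA_adjacent n s t" by blast
  then show ?case
  proof cases
    case 1
    then show ?thesis using relator by (simp add: affA_matrix_def act_act)
  next
    case 2
    then show ?thesis using relator
      by (simp add: affA_matrix_def r act_braid[of s t] act_act)
  next
    case 3
    then show ?thesis using relator
      by (simp add: affA_matrix_def r act_commute[of s t] act_act)
  qed
qed auto

section \<open>Relations of the group as word equalities\<close>

lemma word_eq_square: "s \<in> gens \<Longrightarrow> [s, s] \<approx> []"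
  using cox_eq.relator[of s gens s "affA_matrix n"] by (simp add: affA_matrix_def)

lemma word_eq_of_relator: "u @ v \<approx> [] \<Longrightarrow> u \<approx> rev v"
  by (rule cox_eq_of_relator) (simp_all add: affA_matrix_def)

lemma word_eq_commute:
  assumes "s \<in> gens" "t \<in> gens" "\<not> affA_adjacent n s t" "s \<noteq> t"
  shows "[s, t] \<approx> [t, s]"
  using word_eq_of_relator[of "[s, t]" "[s, t]"]
    cox_eq.relator[of s gens t "affA_matrix n"] assms
  by (simp add: affA_matrix_def numeral_eq_Suc)

lemma word_eq_braid:
  assumes "s \<in> gens" "t \<in> gens" "affA_adjacent n s t"
  shows "[s, t, s] \<approx> [t, s, t]"
proof -
  have "s \<noteq> t" using assms nx_neq by (metis adjacent_iff)
  then show ?thesis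
    using word_eq_of_relator[of "[s, t, s]" "[t, s, t]"]
      cox_eq.relator[of s gens t "affA_matrix n"] assms
    by (simp add: affA_matrix_def numeral_eq_Suc)
qed

lemma word_eq_append: "\<lbrakk>u \<approx> u'; v \<in> lists gens\<rbrakk> \<Longrightarrow> u @ v \<approx> u' @ v"
  by (intro cox_eq.mult cox_eq.refl)

lemma word_eq_Cons: "\<lbrakk>u \<approx> u'; s \<in> gens\<rbrakk> \<Longrightarrow> s # u \<approx> s # u'"
  using cox_eq.mult[of gens "affA_matrix n" "[s]" "[s]" u u'] cox_eq.refl[of "[s]"] by simp

section \<open>The exchange property and the word problem\<close>

lemma base_height: "s \<in> gens \<Longrightarrow> 0 < height n (int n + 1) s (base n)"
  using n2 by (auto simp: affA_gens_def height_def base_def succ_gen_def wrap_def)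

abbreviation window_act where "window_act \<equiv> act n (int n + 1)"
abbreviation window_of where "window_of u \<equiv> run n (int n + 1) u (base n)"
abbreviation rising where "rising u \<equiv> ascending n (int n + 1) u (base n)"
abbreviation window_height where "window_height \<equiv> height n (int n + 1)"

text \<open>
  This is Tits' argument in rank two.  Let \<open>u = t u'\<close>.  If \<open>s\<close> and \<open>t\<close> commute, \<open>s\<close> already goes down
  after \<open>u'\<close>.  If they are adjacent, the heights of \<open>s\<close> and \<open>t\<close> are both negative after \<open>u\<close>, hence so is
  their sum, which is the height of \<open>s\<close> after \<open>u'\<close>; splitting off \<open>s\<close> from \<open>u'\<close> and then \<open>t\<close> from the
  remaining word gives \<open>u = t s t w\<close>, and the braid relation brings \<open>s\<close> to the front.
\<close>
lemma descent_exchange: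
  assumes "u \<in> lists gens" "rising u" "s \<in> gens" "window_height s (window_of u) < 0"
  shows "\<exists>v \<in> lists gens. rising v \<and> length u = Suc (length v) \<and> u \<approx> s # v"
  using assms
proof (induction "length u" arbitrary: u s rule: less_induct)
  case less
  show ?case
  proof (cases u)
    case Nil
    then show ?thesis using less.prems base_height[of s] by simp
  next
    case (Cons t u')
    have t: "t \<in> gens" and u': "u' \<in> lists gens" "rising u'" and pos: "0 < window_height t (window_of u')"
      using less.prems Cons by auto
    have s: "s \<in> gens" and neg: "window_height s (window_act t (window_of u')) < 0"
      using less.prems Cons by auto
    consider "s = t" | "s \<noteq> t" "\<not> affA_adjacent n t s" | "s \<noteq> t" "affA_adjacent n t s" by blast
    then show ?thesis
    proof cases
      case 1
      then show ?thesis using u' Cons less.prems(1) by (auto intro!: bexI[of _ u'] cox_eq.refl)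
    next
      case 2
      have "window_height s (window_of u') < 0" using neg height_act_far[OF t s] 2 by simp
      then obtain v where v: "v \<in> lists gens" "rising v" "length u' = Suc (length v)" "u' \<approx> s # v"
        using less.hyps[of u' s] Cons u' s by auto
      have rv: "window_of v = window_act s (window_of u')"
        using run_cong[OF v(4)] act_act[OF s] by simp
      have "u \<approx> t # s # v" using word_eq_Cons[OF v(4) t] Cons by simp
      also have "t # s # v \<approx> s # t # v"
        using word_eq_append[OF word_eq_commute[OF t s] v(1)] 2 by simp
      finally (cox_eq.trans) have "u \<approx> s # t # v" by simp
      moreover have "window_height t (window_of v) > 0"
        using 2 rv pos height_act_far[OF s t] by (auto simp: affA_adjacent_def insert_commute)
      ultimately show ?thesis using v t Cons by (intro bexI[of _ "t # v"]) auto
    next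
      case 3
      have adj: "affA_adjacent n s t" using 3 by (auto simp: affA_adjacent_def insert_commute)
      have d1: "window_height s (window_act t (window_of u')) = window_height t (window_of u') + window_height s (window_of u')"
        using height_act_adjacent[OF t s] 3 by simp
      then have "window_height s (window_of u') < 0" using neg pos by simp
      then obtain v where v: "v \<in> lists gens" "rising v" "length u' = Suc (length v)" "u' \<approx> s # v"
        using less.hyps[of u' s] Cons u' s by auto
      have rv: "window_of v = window_act s (window_of u')"
        using run_cong[OF v(4)] act_act[OF s] by simp
      have d2: "window_height t (window_of v) = window_height s (window_of u') + window_height t (window_of u')"
        using height_act_adjacent[OF s t adj] rv by simp
      then have "window_height t (window_of v) < 0" using d1 neg by simp
      then obtain w where w: "w \<in> lists gens" "rising w" "length v = Suc (length w)" "v \<approx> t # w"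
        using less.hyps[of v t] Cons v t by auto
      have rw: "window_of w = window_act t (window_of v)"
        using run_cong[OF w(4)] act_act[OF t] by simp
      have d3: "window_height s (window_of w) = window_height t (window_of u')"
        using height_act_adjacent[OF t s] 3 rw d2 rv height_act_self[OF s] by simp
      have d4: "window_height t (window_act s (window_of w)) = - window_height s (window_of u')"
        using height_act_adjacent[OF s t adj] rw d2 d3 height_act_self[OF t] by simp
      have "u \<approx> t # s # v" using word_eq_Cons[OF v(4) t] Cons by simp
      also have "t # s # v \<approx> t # s # t # w" by (intro word_eq_Cons w s t)
      also (cox_eq.trans) have "t # s # t # w \<approx> s # t # s # w"
        using word_eq_append[OF word_eq_braid[OF t s] w(1)] 3 by simp
      finally (cox_eq.trans) have "u \<approx> s # t # s # w" by simp
      moreover have "rising (t # s # w)" using w d3 d4 pos neg d1 by simp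
      ultimately show ?thesis using v w s t Cons by (intro bexI[of _ "t # s # w"]) auto
    qed
  qed
qed

text \<open>
  Distinct residues are what keeps all heights different from zero.  Outside of the positions
  \<open>1, \<dots>, n + 1\<close> a vector is required to vanish, so that equality of functions is equality of windows.
\<close>
definition window :: "(nat \<Rightarrow> int) \<Rightarrow> bool" where
  "window z \<longleftrightarrow> inj_on (\<lambda>k. z k mod (int n + 1)) {1..n + 1} \<and> (\<forall>k. k \<notin> {1..n + 1} \<longrightarrow> z k = 0)"

lemma window_base: "window (base n)"
  by (auto simp: window_def base_def inj_on_def)

lemma window_preserved:
  assumes "window z" "s \<in> gens"
  shows "window (window_act s z)"
proof -
  \<comment> \<open>up to multiples of \<open>n + 1\<close>, a letter permutes the entries by the transposition \<open>p\<close>\<close>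
  define p where "p = (\<lambda>k. if k = s then nx s else if k = nx s then s else k)"
  have p: "bij_betw p {1..n + 1} {1..n + 1}"
    using assms(2) nx_gen[of s] by (intro bij_betw_byWitness[where f' = p]) (auto simp: p_def affA_gens_def)
  have "window_act s z k mod (int n + 1) = z (p k) mod (int n + 1)" for k
    using mod_mult_self2[of _ "int n + 1" 1] minus_mod_self2[of _ "int n + 1"] by (auto simp: act_def p_def wrap_def)
  moreover have "inj_on ((\<lambda>k. z k mod (int n + 1)) \<circ> p) {1..n + 1}"
    using assms(1) p by (intro comp_inj_on) (auto simp: window_def bij_betw_def)
  ultimately have "inj_on (\<lambda>k. window_act s z k mod (int n + 1)) {1..n + 1}"
    by (simp add: comp_def)
  moreover have "window_act s z k = 0" if "k \<notin> {1..n + 1}" for k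
    using that assms nx_gen[of s] by (auto simp: act_def window_def affA_gens_def)
  ultimately show ?thesis by (simp add: window_def)
qed

lemma window_word: "\<lbrakk>u \<in> lists gens; window z\<rbrakk> \<Longrightarrow> window (run n (int n + 1) u z)"
  by (induction u) (auto intro: window_preserved)

lemma window_height_nonzero:
  assumes "window z" "s \<in> gens"
  shows "window_height s z \<noteq> 0"
proof
  assume "window_height s z = 0"
  then have "z s + wrap n (int n + 1) s = z (nx s)" by (simp add: height_def)
  then have "z s mod (int n + 1) = z (nx s) mod (int n + 1)"
    by (metis add.right_neutral mod_add_self2 wrap_def)
  then show False using assms nx_gen[of s] nx_neq[of s]
    by (auto simp: window_def inj_on_def affA_gens_def)
qed

text \<open>
  A letter that goes down cancels against the same letter, brought to the front by the exchange
  property.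
\<close>
lemma ascending_representative:
  assumes "u \<in> lists gens"
  shows "\<exists>v \<in> lists gens. rising v \<and> v \<approx> u \<and> length v \<le> length u"
  using assms
proof (induction u)
  case Nil
  then show ?case by (auto intro: cox_eq.refl)
next
  case (Cons s u)
  then obtain v where v: "v \<in> lists gens" "rising v" "v \<approx> u" "length v \<le> length u" by auto
  have s: "s \<in> gens" using Cons by simp
  show ?case
  proof (cases "0 < window_height s (window_of v)")
    case True
    then show ?thesis using v s word_eq_Cons[OF v(3) s] by (intro bexI[of _ "s # v"]) auto
  next
    case False
    then have "window_height s (window_of v) < 0"
      using window_height_nonzero[OF window_word[OF v(1) window_base] s] by simp
    then obtain w where w: "w \<in> lists gens" "rising w" "length v = Suc (length w)" "v \<approx> s # w"
      using descent_exchange[OF v(1,2) s] by blast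
    have "s # u \<approx> s # v" by (intro word_eq_Cons s cox_eq.sym[OF v(3)])
    also have "s # v \<approx> s # s # w" by (intro word_eq_Cons s w)
    also (cox_eq.trans) have "s # s # w \<approx> w"
      using word_eq_append[OF word_eq_square[OF s] w(1)] by simp
    finally (cox_eq.trans) have "w \<approx> s # u" by (simp add: cox_eq.sym)
    then show ?thesis using w v by (intro bexI[of _ w]) auto
  qed
qed

text \<open>
  If \<open>u = s u'\<close>, then \<open>s\<close> goes down at the common window, so \<open>s\<close> can be brought to the front of the
  other word too, and cancelled.
\<close>
lemma ascending_unique:
  assumes "u \<in> lists gens" "v \<in> lists gens" "rising u" "rising v" "window_of u = window_of v"
  shows "u \<approx> v \<and> length u = length v"
  using assms
proof (induction u arbitrary: v)
  case Nil
  show ?case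
  proof (cases v)
    case Nil
    then show ?thesis by (simp add: cox_eq.refl)
  next
    case (Cons t w)
    then have t: "t \<in> gens" "0 < window_height t (window_of w)" using Nil.prems(1-3) by simp_all
    have "window_act t (window_of w) = base n" using Nil.prems(4)[symmetric] Cons by simp
    then show ?thesis
      using base_height[OF t(1)] height_act_self[OF t(1), of "int n + 1" "window_of w"] t(2) by simp
  qed
next
  case (Cons s u)
  have s: "s \<in> gens" by (rule Cons.hyps)
  have rv: "window_of v = window_act s (window_of u)" using Cons.prems(4)[symmetric] by simp
  then have "window_height s (window_of v) < 0"
    using Cons.prems(2) height_act_self[OF s] by simp
  then obtain w where w: "w \<in> lists gens" "rising w" "length v = Suc (length w)" "v \<approx> s # w"
    using descent_exchange[OF Cons.prems(1,3) s] by blast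
  have "window_act s (window_of w) = window_act s (window_of u)"
    using run_cong[OF w(4), of "int n + 1" "base n"] rv by simp
  then have "window_of w = window_of u" using act_act[OF s] by metis
  then have IH: "u \<approx> w" "length u = length w"
    using Cons.IH[of w] Cons.prems(2) w(1,2) by simp_all
  show ?case
    using cox_eq.trans[OF word_eq_Cons[OF IH(1) s] cox_eq.sym[OF w(4)]] IH(2) w(3) by simp
qed

lemma word_problem:
  assumes "u \<in> lists gens" "v \<in> lists gens"
  shows "u \<approx> v \<longleftrightarrow> window_of u = window_of v"
proof
  assume r: "window_of u = window_of v"
  obtain u' v' where u': "u' \<in> lists gens" "rising u'" "u' \<approx> u" and v': "v' \<in> lists gens" "rising v'" "v' \<approx> v"
    using ascending_representative assms by meson
  have "window_of u' = window_of v'" using run_cong[OF u'(3)] run_cong[OF v'(3)] r by simp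
  then have "u' \<approx> v'" using ascending_unique u' v' by blast
  then show "u \<approx> v" using u' v' by (meson cox_eq.sym cox_eq.trans)
qed (rule run_cong)

lemma elt_eq_iff:
  assumes "u \<in> lists gens" "v \<in> lists gens"
  shows "affA_elt n u = affA_elt n v \<longleftrightarrow> window_of u = window_of v"
  unfolding affA_elt_def cox_elt_eq_iff[OF assms] by (rule word_problem[OF assms])

lemma ascending_length:
  assumes "u \<in> lists gens" "rising u"
  shows "affA_length n (affA_elt n u) = length u"
  unfolding affA_length_def cox_length_def
proof (rule Least_equality)
  show "\<exists>v\<in>lists gens. cox_elt gens (affA_matrix n) v = affA_elt n u \<and> length v = length u"
    using assms by (auto simp: affA_elt_def)
next
  fix k assume "\<exists>v\<in>lists gens. cox_elt gens (affA_matrix n) v = affA_elt n u \<and> length v = k"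
  then obtain v where v: "v \<in> lists gens" "affA_elt n v = affA_elt n u" "length v = k"
    by (auto simp: affA_elt_def)
  obtain w where w: "w \<in> lists gens" "rising w" "w \<approx> v" "length w \<le> length v"
    using ascending_representative v by blast
  have "window_of w = window_of u" using run_cong[OF w(3)] v elt_eq_iff assms by metis
  then show "length u \<le> k" using ascending_unique[of w u] w assms v by auto
qed

lemma ascending_reduced: "\<lbrakk>u \<in> lists gens; rising u\<rbrakk> \<Longrightarrow> affA_reduced n u (affA_elt n u)"
  using ascending_length[of u]
  by (simp add: affA_reduced_def reduced_expression_def affA_elt_def affA_length_def)

end

section \<open>Carrying one entry of a vector past others\<close>

definition pull :: "nat \<Rightarrow> nat \<Rightarrow> (nat \<Rightarrow> int) \<Rightarrow> nat \<Rightarrow> int" where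
  "pull k m z r = (if r = k then z m else if k < r \<and> r \<le> m then z (r - 1) else z r)"

definition push :: "nat \<Rightarrow> nat \<Rightarrow> (nat \<Rightarrow> int) \<Rightarrow> nat \<Rightarrow> int" where
  "push k m z r = (if r = m then z k else if k \<le> r \<and> r < m then z (r + 1) else z r)"

lemma pull_push: "k \<le> m \<Longrightarrow> pull k m (push k m z) = z"
  by (auto simp: pull_def push_def fun_eq_iff)

lemma swap_pull:
  "k < m \<Longrightarrow> (pull (k + 1) m z)(k := pull (k + 1) m z (k + 1), k + 1 := pull (k + 1) m z k) = pull k m z"
  by (rule ext) (auto simp: pull_def)

lemma swap_push:
  "k \<le> m \<Longrightarrow> (push k m z)(m := push k m z (m + 1), m + 1 := push k m z m) = push k (m + 1) z"
  by (rule ext) (auto simp: push_def)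

section \<open>Reading a brick off a lattice vector\<close>

text \<open>
  The position at which the increased entry ends up after \<open>\<B>(j,i)\<close>: carried to \<open>i + 1\<close>, it is pushed
  one place further if the decreased entry stops to the left of it.
\<close>
definition peak :: "nat \<Rightarrow> nat \<Rightarrow> nat" where
  "peak j i = (if i + 1 < j then i + 1 else i + 2)"

text \<open>
  The counterpart for the decreased entry: the entries of \<open>c\<close> from this position up to \<open>n\<close> are those
  that end up to the right of it when \<open>\<B>(j,i)\<close> acts on \<open>c\<close>, apart from the increased entry.
\<close>
definition tail_start :: "nat \<Rightarrow> nat \<Rightarrow> nat" where
  "tail_start j i = (if i + 1 < j then j else j + 1)"

definition first_pos_last_neg :: "nat \<Rightarrow> (nat \<Rightarrow> int) \<Rightarrow> nat \<Rightarrow> nat \<Rightarrow> bool" where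
  "first_pos_last_neg n c p q \<longleftrightarrow> p \<in> {1..n + 1} \<and> q \<in> {1..n + 1} \<and>
     0 < c p \<and> (\<forall>r\<in>{1..<p}. c r \<le> 0) \<and> c q < 0 \<and> (\<forall>r\<in>{q<..n + 1}. 0 \<le> c r)"

text \<open>
  The vectors in front of which \<open>\<B>(j,i)\<close> is the brick of a normal form.  The entry at 1 is about to
  be decreased, and the others of the first range end up to the left of the increased entry; the
  entry at \<open>n + 1\<close> is about to be increased, and the others of the second range end up to the right
  of the decreased entry.
\<close>
definition fits :: "nat \<Rightarrow> (nat \<Rightarrow> int) \<Rightarrow> nat \<Rightarrow> nat \<Rightarrow> bool" where
  "fits n c j i \<longleftrightarrow> (\<forall>r\<in>{1..i + 1}. c r \<le> 0) \<and> (\<forall>r\<in>{tail_start j i..n + 1}. 0 \<le> c r)"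

definition brick_range :: "nat \<Rightarrow> nat \<Rightarrow> nat \<Rightarrow> bool" where
  "brick_range n j i \<longleftrightarrow> 1 \<le> j \<and> j \<le> n + 1 \<and> i < n"

text \<open>
  The inequalities between consecutive bricks as a comparison of positions.  With \<open>peak j' i'\<close> and
  \<open>j'\<close> the positions of the leftmost positive and the rightmost negative entry, this is what \<open>fits\<close>
  demands of the vector that the second brick has produced.
\<close>
definition brick_step :: "nat \<Rightarrow> nat \<times> nat \<Rightarrow> nat \<times> nat \<Rightarrow> bool" where
  "brick_step n b b' \<longleftrightarrow> (case (b, b') of ((j, i), (j', i')) \<Rightarrow>
     brick_range n j' i' \<and> i + 1 < peak j' i' \<and> j' < tail_start j i)"

definition posum :: "nat \<Rightarrow> (nat \<Rightarrow> int) \<Rightarrow> int" where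
  "posum n c = (\<Sum>r\<in>{1..n + 1}. max (c r) 0)"

lemma first_pos_last_neg_unique: "\<lbrakk>first_pos_last_neg n c p q; first_pos_last_neg n c p' q'\<rbrakk> \<Longrightarrow> p = p' \<and> q = q'"
proof -
  assume a: "first_pos_last_neg n c p q" "first_pos_last_neg n c p' q'"
  have "\<not> p < p'" "\<not> p' < p" "\<not> q < q'" "\<not> q' < q"
    using a by (force simp: first_pos_last_neg_def)+
  then show ?thesis by simp
qed

lemma asc_Cons: "k \<le> l \<Longrightarrow> asc k l = k # asc (k + 1) l"
  by (simp add: asc_def upt_conv_Cons)

lemma desc_Suc: "k \<le> Suc l \<Longrightarrow> desc (Suc l) k = Suc l # desc l k"
  by (simp add: desc_def)

lemma rev_asc: "rev (asc k l) = desc l k"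
  by (simp add: asc_def desc_def)

lemma rev_desc: "rev (desc l k) = asc k l"
  by (simp add: asc_def desc_def)

lemma set_asc: "set (asc k l) = {k..l}"
  by (auto simp: asc_def)

lemma set_desc: "set (desc l k) = {k..l}"
  by (auto simp: desc_def)

lemma length_brick:
  "j \<le> n + 1 \<Longrightarrow> length (brick n j i) = n + 2 + i - j"
  by (simp add: brick_def h_word_def asc_def desc_def) arith

context affine_A
begin

lemma act_sigma: "s \<in> {1..n} \<Longrightarrow> act n K s z = z(s := z (s + 1), s + 1 := z s)"
  by (simp add: act_def succ_gen_def wrap_def)

lemma act_affine: "act n K (n + 1) z = z(n + 1 := z 1 - K, 1 := z (n + 1) + K)"
  by (simp add: act_def succ_gen_def wrap_def)

lemma act_affine_Suc: "act n K (Suc n) z = z(Suc n := z 1 - K, 1 := z (Suc n) + K)"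
  using act_affine by simp

lemma run_asc:
  assumes "1 \<le> k" "k \<le> l + 1" "l \<le> n"
  shows "run n K (asc k l) z = pull k (l + 1) z"
  using assms(2,1)
proof (induction k rule: inc_induct)
  case base
  then show ?case by (auto simp: asc_def pull_def fun_eq_iff)
next
  case (step k)
  have "run n K (asc k l) z = act n K k (pull (k + 1) (l + 1) z)"
    using step by (simp add: asc_Cons)
  also have "\<dots> = pull k (l + 1) z"
    using step assms(3) swap_pull[of k "l + 1" z] by (simp add: act_sigma)
  finally show ?case .
qed

text \<open>
  The entry at \<open>l + 1\<close> meets the letters \<open>l, l - 1, \<dots>, k\<close> in turn; it is compared with every entry
  that it passes, which is what makes the criterion for ascending words so simple.
\<close>
lemma ascending_asc:
  assumes "1 \<le> k" "k \<le> l + 1" "l \<le> n"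
  shows "ascending n K (asc k l) z \<longleftrightarrow> (\<forall>r\<in>{k..l}. z (l + 1) < z r)"
  using assms(2,1)
proof (induction k rule: inc_induct)
  case base
  then show ?case by (simp add: asc_def)
next
  case (step k)
  have "height n K k (run n K (asc (k + 1) l) z) = z k - z (l + 1)"
    using step assms(3) by (simp add: run_asc height_def pull_def succ_gen_def wrap_def)
  moreover have "{k..l} = insert k {k + 1..l}" using step by auto
  ultimately show ?case using step by (auto simp: asc_Cons)
qed

lemma run_desc:
  assumes "1 \<le> k" "k \<le> l + 1" "l \<le> n"
  shows "run n K (desc l k) z = push k (l + 1) z"
  using assms(2,3)
proof (induction l)
  case 0
  then show ?case using assms(1) by (auto simp: desc_def push_def fun_eq_iff)
next
  case (Suc l)
  show ?case
  proof (cases "k = Suc l + 1")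
    case True
    then show ?thesis by (auto simp: desc_def push_def fun_eq_iff)
  next
    case False
    then have "run n K (desc (Suc l) k) z = act n K (Suc l) (push k (l + 1) z)"
      using Suc by (simp add: desc_Suc)
    then show ?thesis
      using False Suc.prems swap_push[of k "l + 1" z] by (simp add: act_sigma)
  qed
qed

lemma ascending_desc:
  assumes "1 \<le> k" "k \<le> l + 1" "l \<le> n"
  shows "ascending n K (desc l k) z \<longleftrightarrow> (\<forall>r\<in>{k<..l + 1}. z r < z k)"
  using assms(2,3)
proof (induction l)
  case 0
  then show ?case using assms(1) by (auto simp: desc_def)
next
  case (Suc l)
  show ?case
  proof (cases "k = Suc l + 1")
    case True
    then show ?thesis by (simp add: desc_def)
  next
    case False
    then have k: "k \<le> l + 1" "l \<le> n" using Suc by auto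
    have "height n K (Suc l) (run n K (desc l k) z) = z k - z (l + 2)"
      using k Suc.prems assms(1) by (simp add: run_desc height_def push_def succ_gen_def wrap_def)
    moreover have "{k<..Suc l + 1} = insert (l + 2) {k<..l + 1}" using k by auto
    ultimately show ?thesis using Suc.IH k by (auto simp: desc_Suc)
  qed
qed

lemma brick_eq: "brick n j i = asc j n @ desc i 1 @ [n + 1]"
  by (simp add: brick_def h_word_def)

lemma run_brick:
  assumes "brick_range n j i"
  shows "run n K (brick n j i) z = pull j (n + 1) (push 1 (i + 1) (act n K (n + 1) z))"
  using assms n2 by (simp add: brick_eq run_asc run_desc brick_range_def del: One_nat_def)

lemma run_rev_brick:
  assumes "brick_range n j i"
  shows "run n K (rev (brick n j i)) z = act n K (n + 1) (pull 1 (i + 1) (push j (n + 1) z))"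
  using assms n2
  by (simp add: brick_eq rev_asc rev_desc run_asc run_desc brick_range_def del: One_nat_def)

lemma brick_gens: "1 \<le> j \<Longrightarrow> i < n \<Longrightarrow> brick n j i \<in> lists gens"
  by (auto simp: brick_eq affA_gens_def set_asc set_desc in_lists_conv_set)

lemma run_rev_run:
  assumes "u \<in> lists gens"
  shows "run n K (rev u) (run n K u z) = z"
proof -
  have "rev u @ u \<approx> []" by (rule cox_eq_rev[OF _ assms]) (simp add: affA_matrix_def)
  from run_cong[OF this, of K z] show ?thesis by simp
qed

lemma run_run_rev:
  assumes "u \<in> lists gens"
  shows "run n K u (run n K (rev u) z) = z"
  using run_rev_run[of "rev u" K z] assms by (simp add: in_lists_conv_set)

text \<open>
  After the letter \<open>n + 1\<close> the first entry is positive and the last one negative.  While they are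
  carried to their places, the former passes only entries \<open>\<le> 0\<close> and the latter only entries \<open>\<ge> 0\<close>.
\<close>
lemma fits_brick:
  assumes r: "brick_range n j i" and f: "fits n c j i"
  shows "first_pos_last_neg n (run n 1 (brick n j i) c) (peak j i) j" "ascending n 1 (brick n j i) c"
proof -
  have ri: "1 \<le> j" "j \<le> n + 1" "i + 1 \<le> n" using r n2 by (auto simp: brick_range_def)
  have neg: "c r \<le> 0" if "1 \<le> r" "r \<le> i + 1" for r using f that by (simp add: fits_def)
  have nonneg: "0 \<le> c r" if "tail_start j i \<le> r" "r \<le> n + 1" for r using f that by (simp add: fits_def)
  have ends: "c 1 \<le> 0" "0 \<le> c (n + 1)"
    using neg[of 1] nonneg[of "n + 1"] ri by (auto simp: tail_start_def)
  define b where "b = act n 1 (n + 1) c"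
  have b: "b = c(n + 1 := c 1 - 1, 1 := c (n + 1) + 1)" by (simp only: b_def act_affine)
  define d where "d = push 1 (i + 1) b"
  have dn: "d (n + 1) = c 1 - 1" using ri by (auto simp: d_def b push_def)
  have di: "d (i + 1) = c (n + 1) + 1" using ri by (auto simp: d_def b push_def)
  have dl: "d r = c (r + 1)" if "1 \<le> r" "r \<le> i" for r using ri that by (auto simp: d_def b push_def)
  have dr: "d r = c r" if "i + 1 < r" "r \<le> n" for r using ri that by (auto simp: d_def b push_def)
  have run: "run n 1 (brick n j i) c = pull j (n + 1) d"
    using run_brick[OF r] by (simp add: d_def b_def)
  \<comment> \<open>the entries that the decreased entry passes on its way from the end to position \<open>j\<close>\<close>
  have dpos: "0 \<le> d r" if "j \<le> r" "r \<le> n" for r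
  proof -
    consider "r \<le> i" | "r = i + 1" | "i + 1 < r" by linarith
    then show ?thesis
    proof cases
      case 1
      then show ?thesis using dl[of r] nonneg[of "r + 1"] that ri by (auto simp: tail_start_def)
    next
      case 2
      then show ?thesis using di ends by simp
    next
      case 3
      then show ?thesis using dr[of r] nonneg[of r] that ri by (auto simp: tail_start_def split: if_splits)
    qed
  qed
  have "ascending n 1 [n + 1] c" using ends by (simp add: height_def succ_gen_def wrap_def)
  moreover have "ascending n 1 (desc i 1) b"
    using ri ends neg by (subst ascending_desc) (auto simp: b intro!: order.trans[OF neg])
  moreover have "ascending n 1 (asc j n) d"
    using ri dpos dn ends by (subst ascending_asc) (auto intro!: less_le_trans[OF _ dpos])
  ultimately show "ascending n 1 (brick n j i) c"
    using ri by (simp add: brick_eq ascending_append run_desc d_def b_def del: One_nat_def)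
  have "pull j (n + 1) d j < 0" using dn ends by (simp add: pull_def)
  moreover have "0 \<le> pull j (n + 1) d r" if "j < r" "r \<le> n + 1" for r
    using that dpos[of "r - 1"] by (auto simp: pull_def)
  moreover have "0 < pull j (n + 1) d (peak j i)"
    using di ends ri by (auto simp: pull_def peak_def)
  moreover have "pull j (n + 1) d r \<le> 0" if "1 \<le> r" "r < peak j i" for r
  proof -
    have D: "d s \<le> 0" if "1 \<le> s" "s \<le> i" for s using dl[of s] neg[of "s + 1"] that by simp
    show ?thesis
      using that D[of r] D[of "r - 1"] dn ends ri
      by (cases "r = j") (auto simp: pull_def peak_def split: if_splits)
  qed
  ultimately show "first_pos_last_neg n (run n 1 (brick n j i) c) (peak j i) j"
    using ri unfolding run first_pos_last_neg_def by (auto simp: peak_def)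
qed

text \<open>
  Undoing the brick: \<open>j\<close> is the position of the rightmost negative entry, and \<open>i\<close> is found from the
  position of the leftmost positive one by inverting \<open>peak\<close>.
\<close>
lemma strip_brick:
  assumes m: "first_pos_last_neg n c p q"
  obtains i where "brick_range n q i" "peak q i = p" "fits n (run n 1 (rev (brick n q i)) c) q i"
proof -
  define i where "i = (if p < q then p - 1 else p - 2)"
  have mm: "1 \<le> p" "p \<le> n + 1" "1 \<le> q" "q \<le> n + 1" "0 < c p" "c q < 0"
    "\<And>r. \<lbrakk>1 \<le> r; r < p\<rbrakk> \<Longrightarrow> c r \<le> 0" "\<And>r. \<lbrakk>q < r; r \<le> n + 1\<rbrakk> \<Longrightarrow> 0 \<le> c r"
    using m by (auto simp: first_pos_last_neg_def)
  have "p \<noteq> q" using mm by auto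
  then have pk: "peak q i = p" and r: "brick_range n q i" using mm n2
    by (auto simp: i_def peak_def brick_range_def)
  have ri: "i + 1 \<le> n" using r n2 by (simp add: brick_range_def)
  define d where "d = push q (n + 1) c"
  define b where "b = pull 1 (i + 1) d"
  have e: "run n 1 (rev (brick n q i)) c = b(n + 1 := b 1 - 1, 1 := b (n + 1) + 1)"
    by (simp only: run_rev_brick[OF r] d_def b_def act_affine)
  have dn: "d (n + 1) = c q" by (simp add: d_def push_def)
  have dq: "d r = c r" if "r < q" for r using that mm by (simp add: d_def push_def)
  have dr: "d r = c (r + 1)" if "q \<le> r" "r \<le> n" for r using that mm by (simp add: d_def push_def)
  have di: "d (i + 1) = c p"
    using pk \<open>p \<noteq> q\<close> ri mm dq[of "i + 1"] dr[of "i + 1"] by (auto simp: peak_def split: if_splits)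
  have b1: "b 1 = c p" using di by (simp add: b_def pull_def)
  have bn: "b (n + 1) = c q" using dn ri by (simp add: b_def pull_def)
  have dneg: "d r \<le> 0" if "1 \<le> r" "r \<le> i" for r
    using that pk dq[of r] dr[of r] mm(7)[of r] mm(7)[of "r + 1"] ri mm
    by (cases "r < q") (auto simp: peak_def split: if_splits)
  have dpos: "0 \<le> d r" if "q \<le> r" "r \<le> n" for r
    using that dr[of r] mm(8)[of "r + 1"] by simp
  have "fits n (run n 1 (rev (brick n q i)) c) q i"
    unfolding fits_def
  proof (intro conjI ballI)
    fix r assume r: "r \<in> {1..i + 1}"
    show "run n 1 (rev (brick n q i)) c r \<le> 0"
      using r bn mm(6) dneg[of "r - 1"] ri
      by (cases "r = 1") (auto simp: e b_def pull_def)
  next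
    fix r assume r: "r \<in> {tail_start q i..n + 1}"
    show "0 \<le> run n 1 (rev (brick n q i)) c r"
    proof (cases "r = n + 1")
      case True
      then show ?thesis using b1 mm(5) n2 by (simp add: e)
    next
      case False
      moreover have "r \<noteq> 1" using r mm(3) ri by (auto simp: tail_start_def split: if_splits)
      moreover have "0 \<le> b r"
        using r False \<open>r \<noteq> 1\<close> dpos[of r] dpos[of "r - 1"]
        by (auto simp: b_def pull_def tail_start_def split: if_splits)
      ultimately show ?thesis by (simp add: e)
    qed
  qed
  then show ?thesis using that r pk by blast
qed

text \<open>
  If the first positive and the last negative entry of \<open>c\<close> are where the brick \<open>(j', i')\<close> has put them,
  the sign conditions on \<open>c\<close> become inequalities between \<open>(j, i)\<close> and \<open>(j', i')\<close>.
\<close>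
lemma fits_iff:
  assumes "first_pos_last_neg n c (peak j' i') j'" "brick_range n j i" "brick_range n j' i'"
  shows "fits n c j i \<longleftrightarrow> brick_step n (j, i) (j', i')"
proof
  assume f: "fits n c j i"
  have "\<not> peak j' i' \<le> i + 1" "\<not> tail_start j i \<le> j'"
    using f assms(1) unfolding fits_def first_pos_last_neg_def by (meson atLeastAtMost_iff not_le)+
  then show "brick_step n (j, i) (j', i')" using assms(3) by (simp add: brick_step_def)
next
  assume "brick_step n (j, i) (j', i')"
  then show "fits n c j i"
    using assms(1) by (auto simp: fits_def first_pos_last_neg_def brick_step_def)
qed

lemma fits_zero: "fits n (\<lambda>r. 0) j i"
  by (simp add: fits_def)

section \<open>The sum of the positive entries\<close>

lemma posum_sigma:
  assumes "s \<in> {1..n}"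
  shows "posum n (act n K s c) = posum n c"
proof -
  have "{1..n + 1} = insert s (insert (s + 1) ({1..n + 1} - {s, s + 1}))" using assms by auto
  then have split: "posum n c = max (c s) 0 + (max (c (s + 1)) 0 + (\<Sum>r\<in>{1..n + 1} - {s, s + 1}. max (c r) 0))" for c
    unfolding posum_def by (metis (no_types, lifting) Diff_iff finite.insertI finite_Diff finite_atLeastAtMost insertE insertCI sum.insert n_not_Suc_n Suc_eq_plus1)
  have "(\<Sum>r\<in>{1..n + 1} - {s, s + 1}. max (act n K s c r) 0) = (\<Sum>r\<in>{1..n + 1} - {s, s + 1}. max (c r) 0)"
    using assms by (intro sum.cong) (auto simp: act_sigma)
  then show ?thesis using assms unfolding split by (simp add: act_sigma)
qed

lemma posum_affine:
  "posum n (act n 1 (n + 1) c) = posum n c - max (c 1) 0 - max (c (n + 1)) 0 +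
     max (c 1 - 1) 0 + max (c (n + 1) + 1) 0"
proof -
  have "{1..n + 1} = insert 1 (insert (n + 1) {2..n})" using n2 by auto
  then have split: "posum n c = max (c 1) 0 + (max (c (n + 1)) 0 + (\<Sum>r\<in>{2..n}. max (c r) 0))" for c
    unfolding posum_def using n2 by simp
  have "(\<Sum>r\<in>{2..n}. max (act n 1 (n + 1) c r) 0) = (\<Sum>r\<in>{2..n}. max (c r) 0)"
    by (intro sum.cong) (auto simp: act_affine_Suc)
  then show ?thesis unfolding split using n2 by (simp add: act_affine_Suc)
qed

text \<open>
  The letters \<open>\<sigma>\<^sub>i\<close> exchange entries, and the letter \<open>n + 1\<close> increases only one entry, by one.  This
  is the lower bound for the affine length.
\<close>
lemma posum_le_count:
  "u \<in> lists gens \<Longrightarrow> posum n (run n 1 u (\<lambda>r. 0)) \<le> int (count_list u (n + 1))"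
proof (induction u)
  case Nil
  then show ?case by (simp add: posum_def)
next
  case (Cons s u)
  show ?case
  proof (cases "s = n + 1")
    case True
    then show ?thesis using Cons posum_affine[of "run n 1 u (\<lambda>r. 0)"] by simp
  next
    case False
    then have "s \<in> {1..n}" using Cons by (auto simp: affA_gens_def)
    then show ?thesis using Cons False posum_sigma[of s 1] by simp
  qed
qed

lemma posum_sigma_word: "u \<in> lists {1..n} \<Longrightarrow> posum n (run n K u c) = posum n c"
  by (induction u) (simp_all add: posum_sigma del: atLeastAtMost_iff)

lemma posum_brick:
  assumes "brick_range n j i" "fits n c j i"
  shows "posum n (run n 1 (brick n j i) c) = posum n c + 1"
proof -
  have "asc j n @ desc i 1 \<in> lists {1..n}"
    using assms by (auto simp: brick_range_def set_asc set_desc in_lists_conv_set)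
  then have "posum n (run n 1 (brick n j i) c) = posum n (act n 1 (n + 1) c)"
    using posum_sigma_word[of "asc j n @ desc i 1" 1 "act n 1 (n + 1) c"] by (simp add: brick_eq)
  moreover have "c 1 \<le> 0" "0 \<le> c (n + 1)"
    using assms n2 by (auto simp: fits_def brick_range_def tail_start_def split: if_splits)
  ultimately show ?thesis using posum_affine[of c] by simp
qed

end

section \<open>Sequences of bricks and lattice vectors\<close>

lemma brick_word_Nil: "brick_word n [] = []"
  by (simp add: brick_word_def)

lemma brick_word_Cons: "brick_word n ((j, i) # js) = brick n j i @ brick_word n js"
  by (simp add: brick_word_def)

lemma canonical_word_Nil: "canonical_word [] = []"
  by (simp add: canonical_word_def)

lemma canonical_word_Cons: "canonical_word ((k, l) # kl) = asc k l @ canonical_word kl"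
  by (simp add: canonical_word_def)

lemma canonical_params_Cons:
  "canonical_params n ((k, l) # kl) \<longleftrightarrow>
     1 \<le> k \<and> k \<le> l \<and> l \<le> n \<and> (\<forall>(k', l')\<in>set kl. l' < l) \<and> canonical_params n kl"
  by (auto simp: canonical_params_def)

context affine_A
begin

abbreviation step_ineqs :: "nat \<times> nat \<Rightarrow> nat \<times> nat \<Rightarrow> bool" where
  "step_ineqs b b' \<equiv>
     (snd b' = 0 \<and> fst b' = 1 \<or> 1 \<le> snd b' \<and> snd b' \<le> n - 1 \<and> 1 \<le> fst b' \<and> fst b' \<le> n) \<and>
     fst b' \<le> fst b \<and> snd b' \<ge> snd b \<and>
     (fst b > snd b + 1 \<longrightarrow> fst b' < fst b) \<and> (fst b' > snd b' + 1 \<longrightarrow> snd b' > snd b)"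

text \<open>
  On the right, \<open>j' \<le> n\<close> is implicit in \<open>j' < tail_start j i\<close>, as \<open>tail_start j i \<le> n + 1\<close> for a brick
  \<open>(j, i)\<close> in range, and \<open>i' \<ge> 1\<close> for \<open>j' \<noteq> 1\<close> is implicit in \<open>peak j' i' > 1\<close>.
\<close>
lemma brick_step_iff:
  assumes "brick_range n (fst b) (snd b)"
  shows "step_ineqs b b' \<longleftrightarrow> brick_step n b b'"
proof -
  obtain j i j' i' where b: "b = (j, i)" "b' = (j', i')" by (cases b; cases b')
  have r: "1 \<le> j" "j \<le> n + 1" "i < n" using assms b by (auto simp: brick_range_def)
  have "i' \<le> n - 1 \<longleftrightarrow> i' < n" using n2 by auto
  then show ?thesis
    unfolding b fst_conv snd_conv brick_step_def prod.case brick_range_def peak_def tail_start_def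
    using r n2 by (simp split: if_split) linarith
qed

lemma pairwise_ineqs_step_ineqs:
  "pairwise_ineqs n js \<longleftrightarrow>
     (js \<noteq> [] \<longrightarrow> brick_range n (fst (hd js)) (snd (hd js))) \<and> successively step_ineqs js"
proof -
  have shift: "(\<forall>s. 1 \<le> s \<and> s < m \<longrightarrow> P (s - 1) s) \<longleftrightarrow> (\<forall>s. Suc s < m \<longrightarrow> P s (Suc s))"
    for m and P :: "nat \<Rightarrow> nat \<Rightarrow> bool"
  proof (intro iffI allI impI)
    fix s assume "\<forall>s. 1 \<le> s \<and> s < m \<longrightarrow> P (s - 1) s" "Suc s < m"
    then show "P s (Suc s)" by (auto dest: spec[of _ "Suc s"])
  next
    fix s assume "\<forall>s. Suc s < m \<longrightarrow> P s (Suc s)" "1 \<le> s \<and> s < m"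
    then show "P (s - 1) s" by (cases s) auto
  qed
  have "i \<le> n - 1 \<longleftrightarrow> i < n" for i using n2 by auto
  then have "(js \<noteq> [] \<longrightarrow> 1 \<le> fst (js ! 0) \<and> fst (js ! 0) \<le> n + 1 \<and> snd (js ! 0) \<le> n - 1) \<longleftrightarrow>
      (js \<noteq> [] \<longrightarrow> brick_range n (fst (hd js)) (snd (hd js)))"
    unfolding brick_range_def by (metis hd_conv_nth)
  then show ?thesis
    unfolding pairwise_ineqs_def Let_def successively_conv_nth
      shift[of _ "\<lambda>s t. step_ineqs (js ! s) (js ! t)", symmetric] by (simp only:)
qed

lemma pairwise_ineqs_successively:
  "pairwise_ineqs n js \<longleftrightarrow>
     (js \<noteq> [] \<longrightarrow> brick_range n (fst (hd js)) (snd (hd js))) \<and> successively (brick_step n) js"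
  unfolding pairwise_ineqs_step_ineqs
proof (induction js rule: induct_list012)
  case (3 b b' js)
  have "brick_range n (fst b') (snd b')" if "brick_step n b b'"
    using that by (auto simp: brick_step_def split: prod.splits)
  then show ?case using 3(2) brick_step_iff[of b b'] by (simp only: successively.simps list.sel) blast
qed simp_all

lemma pairwise_ineqs_Cons:
  "pairwise_ineqs n ((j, i) # js) \<longleftrightarrow>
     brick_range n j i \<and> pairwise_ineqs n js \<and> (js \<noteq> [] \<longrightarrow> brick_step n (j, i) (hd js))"
  unfolding pairwise_ineqs_successively
  by (cases js) (auto simp: brick_step_def split: prod.splits)

lemma pairwise_ineqs_Nil: "pairwise_ineqs n []"
  by (simp add: pairwise_ineqs_def)

abbreviation origin :: "nat \<Rightarrow> int" where "origin \<equiv> \<lambda>r. 0"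

lemma pairwise_fits:
  assumes "pairwise_ineqs n ((j, i) # js)"
    and "js = [] \<and> c = origin \<or> js \<noteq> [] \<and> first_pos_last_neg n c (peak (fst (hd js)) (snd (hd js))) (fst (hd js))"
  shows "fits n c j i"
proof (cases js)
  case Nil
  then show ?thesis using assms(2) by (simp add: fits_zero)
next
  case (Cons b js')
  obtain j' i' where b: "b = (j', i')" by (cases b)
  show ?thesis
    using assms fits_iff[of c j' i' j i] Cons b by (simp add: pairwise_ineqs_Cons)
qed

text \<open>
  The three facts are proved together: a brick can be added in front because its index pair fits the
  vector reached so far, and that is known through the signs of this vector.
\<close>
lemma brick_word_spec:
  assumes "pairwise_ineqs n js"
  shows "ascending n 1 (brick_word n js) origin"
    and "posum n (run n 1 (brick_word n js) origin) = int (length js)"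
    and "js \<noteq> [] \<Longrightarrow> first_pos_last_neg n (run n 1 (brick_word n js) origin) (peak (fst (hd js)) (snd (hd js))) (fst (hd js))"
  using assms
proof (induction js)
  case Nil
  { case 1 show ?case by (simp add: brick_word_Nil) }
  { case 2 show ?case by (simp add: brick_word_Nil posum_def) }
  { case 3 then show ?case by simp }
next
  case (Cons b js)
  obtain j i where b: "b = (j, i)" by (cases b)
  {
    assume p: "pairwise_ineqs n (b # js)"
    let ?c = "run n 1 (brick_word n js) origin"
    have p': "brick_range n j i" "pairwise_ineqs n js" using p b by (auto simp: pairwise_ineqs_Cons)
    have "fits n ?c j i"
    proof (rule pairwise_fits[OF p[unfolded b]])
      show "js = [] \<and> ?c = origin \<or>
          js \<noteq> [] \<and> first_pos_last_neg n ?c (peak (fst (hd js)) (snd (hd js))) (fst (hd js))"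
      proof (cases "js = []")
        case True
        then show ?thesis by (simp add: brick_word_Nil)
      next
        case False
        then show ?thesis using Cons(3)[OF False p'(2)] by blast
      qed
    qed
    note f = fits_brick[OF p'(1) this] posum_brick[OF p'(1) this]
    have "ascending n 1 (brick_word n (b # js)) origin"
      "posum n (run n 1 (brick_word n (b # js)) origin) = int (length (b # js))"
      "first_pos_last_neg n (run n 1 (brick_word n (b # js)) origin) (peak (fst b) (snd b)) (fst b)"
      using f Cons(1,2)[OF p'(2)]
      by (simp_all add: b brick_word_Cons ascending_append)
  }
  note * = this
  { case 1 then show ?case by (rule *(1)) }
  { case 2 then show ?case by (rule *(2)) }
  { case 3 then show ?case using *(3)[OF 3(2)] by (simp only: list.sel) }
qed

lemma pairwise_range: "pairwise_ineqs n js \<Longrightarrow> (j, i) \<in> set js \<Longrightarrow> brick_range n j i"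
  by (induction js) (auto simp: pairwise_ineqs_Cons)

lemma brick_word_gens: "pairwise_ineqs n js \<Longrightarrow> brick_word n js \<in> lists gens"
proof (induction js)
  case (Cons b js)
  then show ?case
    by (cases b) (simp add: brick_word_Cons pairwise_ineqs_Cons brick_gens brick_range_def)
qed (simp add: brick_word_Nil)

lemma brick_word_unique:
  assumes "pairwise_ineqs n js" "pairwise_ineqs n js'"
    and "run n 1 (brick_word n js) origin = run n 1 (brick_word n js') origin"
  shows "js = js'"
  using assms
proof (induction js arbitrary: js')
  case Nil
  then have "int (length js') = int (length ([] :: (nat \<times> nat) list))"
    unfolding brick_word_spec(2)[OF Nil(1), symmetric] brick_word_spec(2)[OF Nil(2), symmetric] by (simp only:)
  then show ?case by simp
next
  case (Cons b js)
  have "int (length js') = int (length (b # js))"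
    unfolding brick_word_spec(2)[OF Cons.prems(1), symmetric] brick_word_spec(2)[OF Cons.prems(2), symmetric] Cons.prems(3) ..
  then obtain b' js1 where js': "js' = b' # js1" by (cases js') auto
  obtain j i j' i' where b: "b = (j, i)" "b' = (j', i')" by (cases b; cases b')
  have "first_pos_last_neg n (run n 1 (brick_word n (b # js)) origin) (peak j i) j"
    "first_pos_last_neg n (run n 1 (brick_word n (b # js)) origin) (peak j' i') j'"
    using brick_word_spec(3)[OF Cons.prems(1)] brick_word_spec(3)[OF Cons.prems(2), folded Cons.prems(3)]
    unfolding js' b list.sel fst_conv snd_conv by blast+
  from first_pos_last_neg_unique[OF this] have "j = j'" "i = i'"
    by (auto simp: peak_def split: if_splits)
  then have bb: "b = b'" by (simp add: b)
  have g: "brick n j i \<in> lists gens"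
    using Cons.prems(1) b by (simp add: pairwise_ineqs_Cons brick_gens brick_range_def)
  have "run n 1 (brick n j i) (run n 1 (brick_word n js) origin) = run n 1 (brick n j i) (run n 1 (brick_word n js1) origin)"
    using Cons.prems(3) js' b bb by (simp add: brick_word_Cons)
  then have "run n 1 (brick_word n js) origin = run n 1 (brick_word n js1) origin"
    using run_rev_run[OF g] by metis
  moreover have "pairwise_ineqs n js" "pairwise_ineqs n js1"
    using Cons.prems(1,2) unfolding js' b pairwise_ineqs_Cons by blast+
  ultimately have "js = js1" by (intro Cons.IH)
  then show ?case using js' bb by simp
qed

text \<open>
  The orbit of the origin for period 1, which is the root lattice.
\<close>
definition in_lattice :: "(nat \<Rightarrow> int) \<Rightarrow> bool" where
  "in_lattice c \<longleftrightarrow> (\<Sum>r\<in>{1..n + 1}. c r) = 0 \<and> (\<forall>r. r \<notin> {1..n + 1} \<longrightarrow> c r = 0)"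

lemma in_lattice_act:
  assumes "in_lattice c" "s \<in> gens"
  shows "in_lattice (act n K s c)"
proof -
  have g: "s \<in> {1..n + 1}" "nx s \<in> {1..n + 1}" "s \<noteq> nx s"
    using assms(2) nx_gen[of s] nx_neq[of s] by (auto simp: affA_gens_def)
  then have "{1..n + 1} = insert s (insert (nx s) ({1..n + 1} - {s, nx s}))" by auto
  then have split: "(\<Sum>r\<in>{1..n + 1}. c r) = c s + (c (nx s) + (\<Sum>r\<in>{1..n + 1} - {s, nx s}. c r))"
    for c :: "nat \<Rightarrow> int"
    using g(3) by (metis (no_types, lifting) Diff_iff finite.insertI finite_Diff finite_atLeastAtMost insertE insertCI sum.insert)
  have "(\<Sum>r\<in>{1..n + 1} - {s, nx s}. act n K s c r) = (\<Sum>r\<in>{1..n + 1} - {s, nx s}. c r)"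
    by (intro sum.cong) (auto simp: act_def)
  then have "(\<Sum>r\<in>{1..n + 1}. act n K s c r) = (\<Sum>r\<in>{1..n + 1}. c r)"
    unfolding split using g(3) by (simp add: act_def)
  then show ?thesis using assms(1) g by (auto simp: in_lattice_def act_def)
qed

lemma in_lattice_run: "\<lbrakk>u \<in> lists gens; in_lattice c\<rbrakk> \<Longrightarrow> in_lattice (run n K u c)"
  by (induction u) (auto intro: in_lattice_act)

text \<open>
  A nonzero vector with sum zero has entries of both signs.
\<close>
lemma first_pos_last_neg_exists:
  assumes "in_lattice c" "c \<noteq> origin"
  shows "\<exists>p q. first_pos_last_neg n c p q"
proof -
  obtain r where "c r \<noteq> 0" using assms(2) by auto
  then have r: "r \<in> {1..n + 1}" "c r \<noteq> 0" using assms(1) by (auto simp: in_lattice_def)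
  have s0: "(\<Sum>r\<in>{1..n + 1}. c r) = 0" using assms(1) by (simp add: in_lattice_def)
  have pos: "\<exists>p\<in>{1..n + 1}. 0 < c p"
  proof (rule ccontr)
    assume "\<not> ?thesis"
    then have "(\<Sum>r\<in>{1..n + 1}. - c r) = 0 \<longleftrightarrow> (\<forall>r\<in>{1..n + 1}. - c r = 0)"
      by (intro sum_nonneg_eq_0_iff) (auto simp: not_less)
    then show False using s0 r by (simp add: sum_negf)
  qed
  have neg: "\<exists>p\<in>{1..n + 1}. c p < 0"
  proof (rule ccontr)
    assume "\<not> ?thesis"
    then have "(\<Sum>r\<in>{1..n + 1}. c r) = 0 \<longleftrightarrow> (\<forall>r\<in>{1..n + 1}. c r = 0)"
      by (intro sum_nonneg_eq_0_iff) (auto simp: not_less)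
    then show False using s0 r by simp
  qed
  define P where "P = {r\<in>{1..n + 1}. 0 < c r}"
  define Q where "Q = {r\<in>{1..n + 1}. c r < 0}"
  have P: "finite P" "P \<noteq> {}" and Q: "finite Q" "Q \<noteq> {}" using pos neg by (auto simp: P_def Q_def)
  have "Min P \<in> P" "Max Q \<in> Q" using P Q by (auto intro: Min_in Max_in)
  moreover have "c r \<le> 0" if "1 \<le> r" "r < Min P" for r
    using that Min_le[OF P(1), of r] \<open>Min P \<in> P\<close> by (fastforce simp: P_def)
  moreover have "0 \<le> c r" if "Max Q < r" "r \<le> n + 1" for r
    using that Max_ge[OF Q(1), of r] \<open>Max Q \<in> Q\<close> by (fastforce simp: Q_def)
  ultimately show ?thesis
    unfolding first_pos_last_neg_def by (intro exI[of _ "Min P"] exI[of _ "Max Q"]) (auto simp: P_def Q_def)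
qed

lemma posum_nonneg: "0 \<le> posum n c"
  unfolding posum_def by (rule sum_nonneg) simp

text \<open>
  Stripping bricks from the front, until the sum of the positive entries is used up.
\<close>
lemma brick_word_exists:
  assumes "in_lattice c"
  shows "\<exists>js. pairwise_ineqs n js \<and> run n 1 (brick_word n js) origin = c"
  using assms
proof (induction "nat (posum n c)" arbitrary: c rule: less_induct)
  case less
  show ?case
  proof (cases "c = origin")
    case True
    then show ?thesis by (intro exI[of _ "[]"]) (simp add: pairwise_ineqs_Nil brick_word_Nil)
  next
    case False
    then obtain p j where m: "first_pos_last_neg n c p j" using first_pos_last_neg_exists less.prems by blast
    obtain i where i: "brick_range n j i" "peak j i = p" "fits n (run n 1 (rev (brick n j i)) c) j i"
      using strip_brick[OF m] by blast
    have g: "brick n j i \<in> lists gens" using i(1) by (simp add: brick_gens brick_range_def)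
    define c' where "c' = run n 1 (rev (brick n j i)) c"
    have c: "run n 1 (brick n j i) c' = c" using run_run_rev[OF g] by (simp add: c'_def)
    have "posum n c = posum n c' + 1" using posum_brick[OF i(1), of c'] i(3) c c'_def by simp
    moreover have "in_lattice c'"
      unfolding c'_def using g less.prems by (intro in_lattice_run) (auto simp: in_lists_conv_set)
    ultimately obtain js where js: "pairwise_ineqs n js" "run n 1 (brick_word n js) origin = c'"
      using less.hyps[of c'] posum_nonneg[of c'] by auto
    have "brick_step n (j, i) (hd js)" if ne: "js \<noteq> []"
    proof -
      obtain j' i' where h: "hd js = (j', i')" by (cases "hd js")
      then have "brick_range n j' i'" using pairwise_range[OF js(1), of j' i'] ne hd_in_set[OF ne] by simp
      then show ?thesis
        using fits_iff[of c' j' i' j i] brick_word_spec(3)[OF js(1) ne] js(2) h i(1,3) c'_def by simp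
    qed
    then have "pairwise_ineqs n ((j, i) # js)" using js i by (simp add: pairwise_ineqs_Cons)
    then show ?thesis using js c by (intro exI[of _ "(j, i) # js"]) (simp add: brick_word_Cons)
  qed
qed

section \<open>From windows to lattice vectors\<close>

abbreviation levels :: "(nat \<Rightarrow> int) \<Rightarrow> nat \<Rightarrow> int" where
  "levels z \<equiv> \<lambda>r. z r div (int n + 1)"

lemma div_wrap:
  "(x + wrap n (int n + 1) s) div (int n + 1) = x div (int n + 1) + wrap n 1 s"
  "(x - wrap n (int n + 1) s) div (int n + 1) = x div (int n + 1) - wrap n 1 s"
proof -
  show plus: "(x + wrap n (int n + 1) s) div (int n + 1) = x div (int n + 1) + wrap n 1 s" for x
  proof (cases "s = n + 1")
    case True
    have "(x + (int n + 1)) div (int n + 1) = x div (int n + 1) + 1"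
      by (rule div_add_self2) simp
    then show ?thesis unfolding wrap_def if_P[OF True] .
  next
    case False
    then show ?thesis by (simp add: wrap_def)
  qed
  show "(x - wrap n (int n + 1) s) div (int n + 1) = x div (int n + 1) - wrap n 1 s"
    using plus[of "x - wrap n (int n + 1) s"] by simp
qed

lemma levels_act: "levels (window_act s z) = act n 1 s (levels z)"
  by (rule ext) (simp only: act_def fun_upd_apply div_wrap split: if_split, blast)

lemma levels_run: "levels (run n (int n + 1) u z) = run n 1 u (levels z)"
proof (induction u)
  case (Cons s u)
  then show ?case using levels_act[of s "run n (int n + 1) u z"] by simp
qed simp

text \<open>
  An entry with a strictly larger quotient by \<open>n + 1\<close> is strictly larger.
\<close>
lemma height_levels:
  assumes "0 < height n 1 s (levels z)"
  shows "0 < window_height s z"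
proof -
  have "(z (nx s) - wrap n (int n + 1) s) div (int n + 1) < z s div (int n + 1)"
    using assms by (simp only: height_def div_wrap)
  then have "\<not> z s \<le> z (nx s) - wrap n (int n + 1) s"
    using zdiv_mono1[of "z s" "z (nx s) - wrap n (int n + 1) s" "int n + 1"] by linarith
  then show ?thesis by (simp add: height_def)
qed

lemma ascending_levels: "ascending n 1 u (levels z) \<Longrightarrow> ascending n (int n + 1) u z"
  by (induction u) (auto simp: levels_run[symmetric] intro: height_levels)

lemma levels_base: "levels (base n) = origin"
  by (rule ext) (simp add: base_def div_pos_pos_trivial)

section \<open>Canonical expressions as insertion sort\<close>

lemma canonical_gens: "canonical_params n kl \<Longrightarrow> canonical_word kl \<in> lists {1..n}"
proof (induction kl)
  case (Cons b kl)
  then show ?case by (cases b) (auto simp: canonical_word_Cons canonical_params_Cons set_asc in_lists_conv_set)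
qed (simp add: canonical_word_Nil)

lemma base_less_iff: "\<lbrakk>r \<in> {1..n + 1}; s \<in> {1..n + 1}\<rbrakk> \<Longrightarrow> base n r < base n s \<longleftrightarrow> s < r"
  by (auto simp: base_def)

text \<open>
  Only the first \<open>m\<close> positions are involved, so the smaller entries \<open>base n r\<close> with \<open>r > m\<close> are still in
  place.  This is why \<open>\<lfloor>k,l\<rfloor>\<close>, in front of a word with smaller \<open>l\<close>'s, carries an entry that is smaller
  than all those that it passes.
\<close>
lemma canonical_bounded:
  assumes "canonical_params n kl" "\<forall>(k, l)\<in>set kl. l < m" "m \<le> n + 1"
  shows "rising (canonical_word kl) \<and> (\<forall>r. r \<notin> {1..m} \<longrightarrow> window_of (canonical_word kl) r = base n r) \<and>
    (\<forall>r\<in>{1..m}. base n m \<le> window_of (canonical_word kl) r)"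
  using assms
proof (induction kl arbitrary: m)
  case Nil
  then show ?case by (auto simp: canonical_word_Nil base_def)
next
  case (Cons b kl)
  obtain k l where b: "b = (k, l)" by (cases b)
  have p: "1 \<le> k" "k \<le> l" "l \<le> n" "\<forall>(k', l')\<in>set kl. l' < l" "canonical_params n kl" "l < m"
    using Cons.prems by (auto simp: b canonical_params_Cons)
  define z where "z = window_of (canonical_word kl)"
  have z: "rising (canonical_word kl)" "\<And>r. r \<notin> {1..l} \<Longrightarrow> z r = base n r" "\<And>r. r \<in> {1..l} \<Longrightarrow> base n l \<le> z r"
    using Cons.IH[of l] p by (auto simp: z_def)
  have run: "window_of (canonical_word (b # kl)) = pull k (l + 1) z"
    using p by (simp add: b canonical_word_Cons run_asc z_def)
  have "z (l + 1) = base n (l + 1)" using z(2) by simp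
  then have "z (l + 1) < z r" if "r \<in> {k..l}" for r
    using z(3)[of r] that p base_less_iff[of "l + 1" l] by auto
  then have "rising (canonical_word (b # kl))"
    using z(1) p by (simp add: b canonical_word_Cons ascending_append ascending_asc z_def)
  moreover have "pull k (l + 1) z r = base n r" if "r \<notin> {1..m}" for r
    using that p z(2)[of r] by (auto simp: pull_def)
  moreover have zm: "base n m \<le> z r" if "r \<in> {1..m}" for r
    using that z(2)[of r] z(3)[of r] p Cons.prems(3) by (cases "r \<le> l") (auto simp: base_def)
  have "base n m \<le> pull k (l + 1) z r" if "r \<in> {1..m}" for r
  proof (cases "k < r \<and> r \<le> l + 1")
    case True
    then have "r - 1 \<in> {1..m}" using p by auto
    then show ?thesis using zm[of "r - 1"] True by (simp add: pull_def)
  next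
    case False
    then show ?thesis using that zm[of r] zm[of "l + 1"] p by (auto simp: pull_def)
  qed
  ultimately show ?case unfolding run by blast
qed

lemma canonical_ascending: "canonical_params n kl \<Longrightarrow> rising (canonical_word kl)"
  using canonical_bounded[of kl "n + 1"] by (force simp: canonical_params_def)

text \<open>
  The signature of the first factor \<open>\<lfloor>k,l\<rfloor>\<close>: \<open>l + 1\<close> is the last position where the window differs from
  \<open>base n\<close>, and \<open>k\<close> is the place of the entry that belongs there.
\<close>
lemma canonical_last_inserted:
  assumes "canonical_params n ((k, l) # kl)"
  defines "z \<equiv> window_of (canonical_word ((k, l) # kl))"
  shows "z k = base n (l + 1)" "\<And>r. \<lbrakk>1 \<le> r; r \<le> l + 1; r \<noteq> k\<rbrakk> \<Longrightarrow> base n (l + 1) < z r"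
    "\<And>r. l + 1 < r \<Longrightarrow> z r = base n r"
proof -
  have p: "1 \<le> k" "k \<le> l" "l \<le> n" "\<forall>(k', l')\<in>set kl. l' < l" "canonical_params n kl"
    using assms(1) by (auto simp: canonical_params_Cons)
  define y where "y = window_of (canonical_word kl)"
  have y: "\<And>r. r \<notin> {1..l} \<Longrightarrow> y r = base n r" "\<And>r. r \<in> {1..l} \<Longrightarrow> base n l \<le> y r"
    using canonical_bounded[of kl l] p by (auto simp: y_def)
  have z: "z = pull k (l + 1) y"
    using p by (simp add: z_def canonical_word_Cons run_asc y_def)
  have b: "base n (l + 1) < base n l" using p by (simp add: base_def)
  show "z k = base n (l + 1)" using y(1)[of "l + 1"] by (simp add: z pull_def)
  show "base n (l + 1) < z r" if "1 \<le> r" "r \<le> l + 1" "r \<noteq> k" for r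
  proof -
    have "r - 1 \<in> {1..l}" if "k < r" using that \<open>r \<le> l + 1\<close> p by auto
    then show ?thesis using that y(2)[of r] y(2)[of "r - 1"] b p(2) by (auto simp: z pull_def)
  qed
  show "z r = base n r" if "l + 1 < r" for r
    using that p y(1)[of r] by (simp add: z pull_def)
qed

lemma canonical_unique:
  assumes "canonical_params n kl" "canonical_params n kl'"
    "window_of (canonical_word kl) = window_of (canonical_word kl')"
  shows "kl = kl'"
  using assms
proof (induction kl arbitrary: kl')
  case Nil
  show ?case
  proof (cases kl')
    case (Cons b kl1)
    obtain k l where b: "b = (k, l)" by (cases b)
    have "window_of (canonical_word kl') k = base n (l + 1)"
      using canonical_last_inserted(1) Nil.prems(2) unfolding Cons b by blast
    moreover have "window_of (canonical_word kl') k = base n k"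
      using Nil.prems(3)[symmetric] by (simp add: canonical_word_Nil)
    moreover have "1 \<le> k" "k \<le> l" "l \<le> n" using Nil.prems(2) by (auto simp: Cons b canonical_params_Cons)
    ultimately show ?thesis by (simp add: base_def)
  qed simp
next
  case (Cons b kl)
  obtain k l where b: "b = (k, l)" by (cases b)
  note Z = canonical_last_inserted[OF Cons.prems(1)[unfolded b]]
  have p: "1 \<le> k" "k \<le> l" "l \<le> n" using Cons.prems(1) by (auto simp: b canonical_params_Cons)
  show ?case
  proof (cases kl')
    case Nil
    then have "window_of (canonical_word ((k, l) # kl)) k = base n k"
      using Cons.prems(3) by (simp add: canonical_word_Nil b)
    then show ?thesis using Z(1) p by (simp add: base_def)
  next
    case (Cons b' kl1)
    obtain k' l' where b': "b' = (k', l')" by (cases b')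
    have p': "1 \<le> k'" "k' \<le> l'" "l' \<le> n" using Cons.prems(2) by (auto simp: Cons b' canonical_params_Cons)
    note Z' = canonical_last_inserted[OF Cons.prems(2)[unfolded Cons b'], folded b' Cons, folded Cons.prems(3), unfolded b]
    have "\<not> l < l'"
      using Z(3)[of "l' + 1"] Z'(2)[of "l' + 1"] p' by auto
    moreover have "\<not> l' < l"
      using Z'(3)[of "l + 1"] Z(2)[of "l + 1"] p by auto
    ultimately have l: "l = l'" by simp
    have "k = k'" using Z(2)[of k'] Z'(1) p' l by fastforce
    then have bb: "b = b'" using l b b' by simp
    have "run n (int n + 1) (asc k l) (window_of (canonical_word kl)) = run n (int n + 1) (asc k l) (window_of (canonical_word kl1))"
      using Cons.prems(3) by (simp add: Cons b bb[symmetric] canonical_word_Cons)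
    moreover have "asc k l \<in> lists gens" using p by (auto simp: set_asc affA_gens_def in_lists_conv_set)
    ultimately have "window_of (canonical_word kl) = window_of (canonical_word kl1)"
      using run_rev_run by metis
    then have "kl = kl1"
      using Cons.IH[of kl1] Cons.prems(1,2) by (simp add: Cons b b' canonical_params_Cons)
    then show ?thesis using Cons bb by simp
  qed
qed

text \<open>
  The \<open>m\<close> largest values of \<open>base n\<close>, in any order, are sorted by carrying the smallest of them to
  position \<open>m\<close> and then treating the first \<open>m - 1\<close> positions.
\<close>
lemma canonical_exists:
  assumes "m \<le> n + 1" "inj_on z {1..m}" "\<forall>r\<in>{1..m}. base n m \<le> z r \<and> z r \<le> int n"
    "\<forall>r. r \<notin> {1..m} \<longrightarrow> z r = base n r"
  shows "\<exists>kl. canonical_params n kl \<and> (\<forall>(k, l)\<in>set kl. l < m) \<and> window_of (canonical_word kl) = z"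
  using assms
proof (induction m arbitrary: z)
  case 0
  then have "z = base n" by (auto simp: fun_eq_iff)
  then show ?case by (intro exI[of _ "[]"]) (simp add: canonical_params_def canonical_word_Nil)
next
  case (Suc m)
  have bm: "base n (Suc m) = int n - int m" using Suc.prems(1) by (simp add: base_def)
  have "z ` {1..Suc m} = {int n - int m..int n}"
  proof (rule card_subset_eq)
    show "z ` {1..Suc m} \<subseteq> {int n - int m..int n}" using Suc.prems(3) bm by auto
    show "card (z ` {1..Suc m}) = card {int n - int m..int n}"
      using Suc.prems(2) by (simp add: card_image)
  qed simp
  moreover have "base n (Suc m) \<in> {int n - int m..int n}" using bm by simp
  ultimately obtain k where k: "1 \<le> k" "k \<le> Suc m" "z k = base n (Suc m)"
    by (metis (no_types, lifting) atLeastAtMost_iff imageE)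
  \<comment> \<open>undo the insertion of the smallest of the values, found at position \<open>k\<close>\<close>
  define y where "y = push k (m + 1) z"
  have z: "z = pull k (m + 1) y" using k by (simp add: y_def pull_push)
  have other: "base n (Suc m) < z r" if "1 \<le> r" "r \<le> Suc m" "r \<noteq> k" for r
  proof -
    have "z r \<noteq> z k" using Suc.prems(2) k that by (auto simp: inj_on_def)
    moreover have "base n (Suc m) \<le> z r" using Suc.prems(3) that by simp
    ultimately show ?thesis using k by simp
  qed
  have ey: "y r = z (if r < k then r else r + 1)" if "1 \<le> r" "r \<le> m" for r
    using that by (simp add: y_def push_def)
  have "inj_on y {1..m}"
  proof (rule inj_onI)
    fix r s assume rs: "r \<in> {1..m}" "s \<in> {1..m}" "y r = y s"
    then have "(if r < k then r else r + 1) = (if s < k then s else s + 1)"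
      using ey[of r] ey[of s] by (intro inj_onD[OF Suc.prems(2)]) auto
    then show "r = s" by (auto split: if_splits)
  qed
  moreover have "base n m \<le> y r \<and> y r \<le> int n" if "r \<in> {1..m}" for r
  proof -
    let ?r = "if r < k then r else r + 1"
    have "base n m \<le> base n (Suc m) + 1" using bm that Suc.prems(1) by (auto simp: base_def)
    then show ?thesis using that ey[of r] other[of ?r] Suc.prems(3)[rule_format, of ?r] k by auto
  qed
  moreover have "y r = base n r" if "r \<notin> {1..m}" for r
    using that k Suc.prems(4)[rule_format, of r] by (auto simp: y_def push_def)
  ultimately obtain kl where kl: "canonical_params n kl" "\<forall>(k, l)\<in>set kl. l < m" "window_of (canonical_word kl) = y"
    using Suc.IH[of y] Suc.prems(1) by auto
  show ?case
  proof (cases "k = Suc m")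
    case True
    then have "z = y" using z by (auto simp: pull_def fun_eq_iff)
    then show ?thesis using kl by (intro exI[of _ kl]) auto
  next
    case False
    then have "canonical_params n ((k, m) # kl)" using kl k Suc.prems(1) by (auto simp: canonical_params_Cons)
    moreover have "window_of (canonical_word ((k, m) # kl)) = z"
      using kl(3) k False Suc.prems(1) z by (simp add: canonical_word_Cons run_asc)
    ultimately show ?thesis using kl(2) by (intro exI[of _ "(k, m) # kl"]) auto
  qed
qed

section \<open>Normal forms\<close>

lemma sigma_word_fixes_origin: "u \<in> lists {1..n} \<Longrightarrow> run n K u origin = origin"
proof (induction u)
  case (Cons s u)
  then have "run n K (s # u) origin = act n K s origin" by simp
  also have "\<dots> = origin" using Cons.prems by (auto simp: act_sigma fun_eq_iff)
  finally show ?case .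
qed simp

lemma sigma_word_gens: "u \<in> lists {1..n} \<Longrightarrow> u \<in> lists gens"
  by (auto simp: affA_gens_def in_lists_conv_set)

lemma levels_run_base: "levels (window_of u) = run n 1 u origin"
  using levels_run[of u "base n"] by (simp only: levels_base)

lemma levels_canonical: "canonical_params n kl \<Longrightarrow> levels (window_of (canonical_word kl)) = origin"
  unfolding levels_run_base by (intro sigma_word_fixes_origin canonical_gens)

lemma normal_form_gens:
  "\<lbrakk>pairwise_ineqs n js; canonical_params n kl\<rbrakk> \<Longrightarrow> brick_word n js @ canonical_word kl \<in> lists gens"
  using brick_word_gens[of js] sigma_word_gens[OF canonical_gens[of kl]] by simp

text \<open>
  The bricks go up from the origin; the window of the canonical part has the origin as its vector of
  quotients, so they also go up from there.
\<close>
lemma normal_form_ascending: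
  assumes "pairwise_ineqs n js" "canonical_params n kl"
  shows "rising (brick_word n js @ canonical_word kl)"
proof -
  have "ascending n 1 (brick_word n js) (levels (window_of (canonical_word kl)))"
    unfolding levels_canonical[OF assms(2)] by (rule brick_word_spec(1)[OF assms(1)])
  then show ?thesis
    using ascending_levels canonical_ascending[OF assms(2)] by (simp add: ascending_append)
qed

lemma levels_normal_form:
  assumes "canonical_params n kl"
  shows "levels (window_of (brick_word n js @ canonical_word kl)) = run n 1 (brick_word n js) origin"
proof -
  have "levels (window_of (brick_word n js @ canonical_word kl)) = run n 1 (brick_word n js @ canonical_word kl) origin"
    by (rule levels_run_base)
  also have "\<dots> = run n 1 (brick_word n js) (run n 1 (canonical_word kl) origin)" by simp
  also have "run n 1 (canonical_word kl) origin = origin"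
    by (rule sigma_word_fixes_origin[OF canonical_gens[OF assms]])
  finally show ?thesis .
qed

text \<open>
  The quotients of the window determine the bricks; undoing these leaves the window of the canonical
  part.
\<close>
lemma normal_form_unique:
  assumes p: "pairwise_ineqs n js" "canonical_params n kl" and p': "pairwise_ineqs n js'" "canonical_params n kl'"
    and e: "affA_elt n (brick_word n js @ canonical_word kl) = affA_elt n (brick_word n js' @ canonical_word kl')"
  shows "js = js' \<and> kl = kl'"
proof -
  have r: "window_of (brick_word n js @ canonical_word kl) = window_of (brick_word n js' @ canonical_word kl')"
    using e elt_eq_iff[OF normal_form_gens[OF p] normal_form_gens[OF p']] by simp
  have js: "js = js'"
  proof (rule brick_word_unique[OF p(1) p'(1)])
    show "run n 1 (brick_word n js) origin = run n 1 (brick_word n js') origin"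
      using levels_normal_form[OF p(2), of js] levels_normal_form[OF p'(2), of js'] unfolding r by (rule HOL.trans[OF HOL.sym])
  qed
  have "run n (int n + 1) (brick_word n js) (window_of (canonical_word kl)) =
      run n (int n + 1) (brick_word n js) (window_of (canonical_word kl'))"
    using r js by simp
  then have "window_of (canonical_word kl) = window_of (canonical_word kl')"
    using run_rev_run[OF brick_word_gens[OF p(1)]] by metis
  then show ?thesis using canonical_unique[OF p(2) p'(2)] js by simp
qed

text \<open>
  Choose bricks for the quotients of the window of \<open>u\<close> and undo them: the resulting window has
  quotients 0, so its entries are \<open>0, \<dots>, n\<close> in some order, and a canonical word reaches it.
\<close>
lemma normal_form_exists:
  assumes "u \<in> lists gens"
  shows "\<exists>js kl. pairwise_ineqs n js \<and> canonical_params n kl \<and>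
    affA_elt n u = affA_elt n (brick_word n js @ canonical_word kl)"
proof -
  have "in_lattice (run n 1 u origin)"
    using assms by (intro in_lattice_run) (auto simp: in_lattice_def)
  then obtain js where js: "pairwise_ineqs n js" "run n 1 (brick_word n js) origin = run n 1 u origin"
    using brick_word_exists by blast
  have g: "brick_word n js \<in> lists gens" by (rule brick_word_gens[OF js(1)])
  then have g': "rev (brick_word n js) \<in> lists gens" by (simp add: in_lists_conv_set)
  define z where "z = window_of (rev (brick_word n js) @ u)"
  have "levels z = run n 1 (rev (brick_word n js)) (run n 1 u origin)"
    unfolding z_def levels_run_base by simp
  also have "\<dots> = origin" unfolding js(2)[symmetric] by (rule run_rev_run[OF g])
  finally have lz: "levels z = origin" .
  have w: "window z" unfolding z_def using g' assms by (intro window_word window_base) simp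
  have zr: "0 \<le> z r \<and> z r \<le> int n" for r
  proof -
    have "z r div (int n + 1) = 0" using fun_cong[OF lz, of r] by simp
    then have "z r = z r mod (int n + 1)" using div_mult_mod_eq[of "z r" "int n + 1"] by simp
    moreover have "0 \<le> z r mod (int n + 1)" "z r mod (int n + 1) < int n + 1"
      by (rule pos_mod_sign pos_mod_bound, simp)+
    ultimately show ?thesis by linarith
  qed
  then have "z r mod (int n + 1) = z r" for r
    using zr[of r] by (intro mod_pos_pos_trivial) linarith+
  then have "inj_on z {1..n + 1}" using w by (simp add: window_def)
  moreover have "\<forall>r. r \<notin> {1..n + 1} \<longrightarrow> z r = base n r" using w by (auto simp: window_def base_def)
  moreover have "base n (n + 1) = 0" by (simp add: base_def)
  ultimately obtain kl where kl: "canonical_params n kl" "window_of (canonical_word kl) = z"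
    using canonical_exists[of "n + 1" z] zr by auto
  have "window_of (brick_word n js @ canonical_word kl) =
      run n (int n + 1) (brick_word n js) (run n (int n + 1) (rev (brick_word n js)) (window_of u))"
    using kl(2) by (simp add: z_def)
  also have "\<dots> = window_of u" by (rule run_run_rev[OF g])
  finally have "window_of (brick_word n js @ canonical_word kl) = window_of u" .
  then have "affA_elt n u = affA_elt n (brick_word n js @ canonical_word kl)"
    using elt_eq_iff[OF assms normal_form_gens[OF js(1) kl(1)]] by simp
  then show ?thesis using js(1) kl(1) by blast
qed

lemma count_brick_word: "pairwise_ineqs n js \<Longrightarrow> count_list (brick_word n js) (n + 1) = length js"
proof (induction js)
  case (Cons b js)
  obtain j i where b: "b = (j, i)" by (cases b)
  have "count_list (asc j n) (n + 1) = 0" "count_list (desc i 1) (n + 1) = 0"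
    using Cons.prems by (auto simp: b count_list_0_iff set_asc set_desc pairwise_ineqs_Cons brick_range_def)
  then show ?case using Cons by (simp add: b brick_word_Cons brick_eq pairwise_ineqs_Cons)
qed (simp add: brick_word_Nil)

lemma count_normal_form:
  assumes "pairwise_ineqs n js" "canonical_params n kl"
  shows "count_list (brick_word n js @ canonical_word kl) (n + 1) = length js"
proof -
  have "n + 1 \<notin> set (canonical_word kl)" using canonical_gens[OF assms(2)] by (auto simp: in_lists_conv_set)
  then show ?thesis using count_brick_word[OF assms(1)] by (simp add: count_list_0_iff)
qed

text \<open>
  Any expression of the element leads to the same lattice vector, whose positive entries sum up to
  the number of bricks.
\<close>
lemma affine_length_normal_form:
  assumes "pairwise_ineqs n js" "canonical_params n kl"
  shows "affine_length n (affA_elt n (brick_word n js @ canonical_word kl)) = length js"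
  unfolding affine_length_def
proof (rule Least_equality)
  let ?u = "brick_word n js @ canonical_word kl"
  show "\<exists>u. affA_reduced n u (affA_elt n ?u) \<and> count_list u (n + 1) = length js"
    using ascending_reduced[OF normal_form_gens[OF assms] normal_form_ascending[OF assms]] count_normal_form[OF assms] by blast
  fix k assume "\<exists>v. affA_reduced n v (affA_elt n ?u) \<and> count_list v (n + 1) = k"
  then obtain v where v: "v \<in> lists gens" "affA_elt n v = affA_elt n ?u" "count_list v (n + 1) = k"
    by (auto simp: affA_reduced_def reduced_expression_def affA_elt_def)
  have "window_of v = window_of ?u" using elt_eq_iff[OF v(1) normal_form_gens[OF assms]] v(2) by simp
  then have "run n 1 v origin = run n 1 (brick_word n js) origin"
    using levels_normal_form[OF assms(2), of js] levels_run_base[of v] by metis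
  then have "int (length js) \<le> int k"
    using posum_le_count[OF v(1)] brick_word_spec(2)[OF assms(1)] v(3) by simp
  then show "length js \<le> k" by simp
qed

lemma length_brick_word:
  "pairwise_ineqs n js \<Longrightarrow> int (length (brick_word n js)) =
     (\<Sum>s<length js. int n + 1 + int (snd (js ! s)) + 1 - int (fst (js ! s)))"
proof (induction js)
  case (Cons b js)
  obtain j i where b: "b = (j, i)" by (cases b)
  have "j \<le> n + 1" using Cons.prems by (simp add: b pairwise_ineqs_Cons brick_range_def)
  then have "int (length (brick n j i)) = int n + 1 + int i + 1 - int j" by (simp add: length_brick)
  then show ?case
    using Cons by (simp add: b brick_word_Cons pairwise_ineqs_Cons sum.lessThan_Suc_shift del: sum.lessThan_Suc)
qed (simp add: brick_word_Nil)

lemma length_elt_le: "u \<in> lists gens \<Longrightarrow> affA_length n (affA_elt n u) \<le> length u"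
  unfolding affA_length_def cox_length_def affA_elt_def by (rule Least_le) blast

lemma mult_elt:
  "\<lbrakk>u \<in> lists gens; v \<in> lists gens\<rbrakk> \<Longrightarrow>
     affA_elt n u \<otimes>\<^bsub>coxeter_group gens (affA_matrix n)\<^esub> affA_elt n v = affA_elt n (u @ v)"
  by (simp only: affA_elt_def mult_cox_elt)

lemma brick_word_last:
  "js \<noteq> [] \<Longrightarrow> \<exists>u. brick_word n js = u @ [n + 1]"
  by (cases js rule: rev_cases) (auto simp: brick_word_def brick_def)

text \<open>
  The letter \<open>n + 1\<close> cancels the last letter of the last brick, while appending \<open>\<sigma>\<^sub>s\<close> gives a normal
  form with canonical part \<open>\<lfloor>s,s\<rfloor>\<close>, which is one letter longer.
\<close>
lemma brick_word_right_descents: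
  assumes "js \<noteq> []" "pairwise_ineqs n js"
  shows "affA_right_descents n (affA_elt n (brick_word n js)) = {n + 1}"
proof -
  let ?w = "affA_elt n (brick_word n js)"
  have g: "brick_word n js \<in> lists gens" by (rule brick_word_gens[OF assms(2)])
  have len: "affA_length n ?w = length (brick_word n js)"
    using ascending_length[OF g] normal_form_ascending[OF assms(2), of "[]"]
    by (simp add: canonical_params_def canonical_word_Nil)
  have d: "s \<in> affA_right_descents n ?w \<longleftrightarrow>
      s \<in> gens \<and> affA_length n (affA_elt n (brick_word n js @ [s])) < length (brick_word n js)" for s
  proof (cases "s \<in> gens")
    case True
    then have "?w \<otimes>\<^bsub>coxeter_group gens (affA_matrix n)\<^esub> affA_elt n [s] = affA_elt n (brick_word n js @ [s])"
      using mult_elt[OF g, of "[s]"] by simp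
    then show ?thesis
      using len True by (simp add: affA_right_descents_def right_descents_def affA_length_def affA_elt_def)
  next
    case False
    then show ?thesis by (simp add: affA_right_descents_def right_descents_def)
  qed
  have up: "\<not> affA_length n (affA_elt n (brick_word n js @ [s])) < length (brick_word n js)" if "s \<in> {1..n}" for s
  proof -
    have c: "canonical_params n [(s, s)]" "canonical_word [(s, s)] = [s]"
      using that by (auto simp: canonical_params_def canonical_word_def asc_def)
    show ?thesis
      using ascending_length[OF normal_form_gens[OF assms(2) c(1)] normal_form_ascending[OF assms(2) c(1)]] c(2) by simp
  qed
  have a: "n + 1 \<in> gens" by (simp add: affA_gens_def)
  obtain u where u: "brick_word n js = u @ [n + 1]" using brick_word_last[OF assms(1)] by blast
  have ug: "u \<in> lists gens" using g u by simp
  have "u @ [n + 1, n + 1] \<approx> u @ []"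
    by (intro cox_eq.mult cox_eq.refl ug word_eq_square a)
  then have "affA_elt n (brick_word n js @ [n + 1]) = affA_elt n u"
    using ug a u by (simp add: affA_elt_def cox_elt_eq_iff)
  then have down: "affA_length n (affA_elt n (brick_word n js @ [n + 1])) < length (brick_word n js)"
    using length_elt_le[OF ug] u by simp
  show ?thesis
  proof (intro Set.set_eqI iffI)
    fix s assume "s \<in> affA_right_descents n ?w"
    then have "s \<in> gens" "s \<notin> {1..n}" using d up by blast+
    then show "s \<in> {n + 1}" by (auto simp: affA_gens_def)
  next
    fix s assume "s \<in> {n + 1}"
    then show "s \<in> affA_right_descents n ?w" using d[of "n + 1"] a down by simp
  qed
qed

lemma sigma_word_finA: "u \<in> lists {1..n} \<Longrightarrow> affA_elt n u \<in> finA n"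
proof (induction u)
  case Nil
  then show ?case
    unfolding finA_def affA_elt_def using one_coxeter_group[of gens "affA_matrix n"]
    by (metis affA_def generate.one)
next
  case (Cons s u)
  have s: "[s] \<in> lists gens" "u \<in> lists gens" using Cons.prems by (auto intro: sigma_word_gens simp: affA_gens_def)
  have "affA_elt n [s] \<in> finA n" unfolding finA_def using Cons.prems by (intro generate.incl) auto
  then have "affA_elt n [s] \<otimes>\<^bsub>affA n\<^esub> affA_elt n u \<in> finA n"
    using Cons.IH Cons.prems unfolding finA_def by (auto intro: generate.eng)
  then show ?case using mult_elt[OF s] by (simp add: affA_def)
qed

lemma affine_form_iff:
  "affine_form n m w js x \<longleftrightarrow> length js = m \<and> pairwise_ineqs n js \<and>
     (\<exists>kl. canonical_params n kl \<and> x = canonical_word kl) \<and> w = affA_elt n (brick_word n js @ x)"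
proof -
  have "affA_elt n x \<in> finA n" if "\<exists>kl. canonical_params n kl \<and> x = canonical_word kl"
    using that sigma_word_finA[OF canonical_gens] by (elim exE conjE) simp
  then show ?thesis
    unfolding affine_form_def is_canonical_expression_def by (simp only: bex_simps) blast
qed

lemma normal_form_length:
  assumes "pairwise_ineqs n js" "canonical_params n kl"
  shows "int (affA_length n (affA_elt n (brick_word n js @ canonical_word kl))) =
    int (affA_length n (affA_elt n (canonical_word kl))) +
    (\<Sum>s<length js. int n + 1 + int (snd (js ! s)) + 1 - int (fst (js ! s)))"
  using ascending_length[OF normal_form_gens[OF assms] normal_form_ascending[OF assms]]
    ascending_length[OF sigma_word_gens[OF canonical_gens[OF assms(2)]] canonical_ascending[OF assms(2)]]
    length_brick_word[OF assms(1)] by simp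

end

theorem theorem2p13:
  fixes n :: nat
  assumes "n \<ge> 2"
  shows
    "(\<forall>(m::nat) js. m \<ge> 1 \<and> length js = m \<and> pairwise_ineqs n js \<longrightarrow>
        affA_reduced n (brick_word n js) (affA_elt n (brick_word n js)) \<and>
        affine_length_reduced n (brick_word n js) (affA_elt n (brick_word n js)) \<and>
        affA_right_descents n (affA_elt n (brick_word n js)) = {n + 1}) \<and>
     (\<forall>(m::nat) w. m \<ge> 1 \<and> w \<in> carrier (affA n) \<and> affine_length n w = m \<longrightarrow>
        (\<exists>!(js, x). affine_form n m w js x) \<and>
        (\<forall>js x. affine_form n m w js x \<longrightarrow>
           affA_reduced n (brick_word n js @ x) w \<and>
           int (affA_length n w) =
             int (affA_length n (affA_elt n x)) +
             (\<Sum>s<m. int n + 1 + int (snd (js ! s)) + 1 - int (fst (js ! s)))) \<and>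
        (\<exists>!(js, kl). length js = m \<and> pairwise_ineqs n js \<and> canonical_params n kl \<and>
           w = affA_elt n (brick_word n js @ canonical_word kl)) \<and>
        (\<forall>js kl. length js = m \<and> pairwise_ineqs n js \<and> canonical_params n kl \<and>
           w = affA_elt n (brick_word n js @ canonical_word kl) \<longrightarrow>
           affA_reduced n (brick_word n js @ canonical_word kl) w))"
proof -
  interpret affine_A n by standard (rule assms)
  have reduced: "affA_reduced n (brick_word n js @ canonical_word kl)
      (affA_elt n (brick_word n js @ canonical_word kl))"
    if "pairwise_ineqs n js" "canonical_params n kl" for js kl
    by (rule ascending_reduced[OF normal_form_gens[OF that] normal_form_ascending[OF that]])
  have empty: "canonical_params n []" "canonical_word [] = []"
    by (simp_all add: canonical_params_def canonical_word_Nil)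
  show ?thesis
  proof (rule conjI; intro allI impI; elim conjE)
    fix m :: nat and js assume m: "1 \<le> m" "length js = m" and p: "pairwise_ineqs n js"
    have r: "affA_reduced n (brick_word n js) (affA_elt n (brick_word n js))"
      using reduced[OF p empty(1)] empty(2) by simp
    moreover have "affine_length n (affA_elt n (brick_word n js)) = length js"
      using affine_length_normal_form[OF p empty(1)] empty(2) by simp
    ultimately show "affA_reduced n (brick_word n js) (affA_elt n (brick_word n js)) \<and>
        affine_length_reduced n (brick_word n js) (affA_elt n (brick_word n js)) \<and>
        affA_right_descents n (affA_elt n (brick_word n js)) = {n + 1}"
      using brick_word_right_descents[of js] p count_brick_word[OF p] m
      by (cases "js = []") (simp_all add: affine_length_reduced_def)
  next
    fix m :: nat and w assume w: "w \<in> carrier (affA n)" "affine_length n w = m"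
    obtain u where u: "u \<in> lists gens" "w = affA_elt n u"
      using w(1) by (auto simp: affA_def carrier_coxeter_group affA_elt_def)
    obtain js kl where f: "pairwise_ineqs n js" "canonical_params n kl"
      "w = affA_elt n (brick_word n js @ canonical_word kl)"
      using normal_form_exists[OF u(1)] u(2) by blast
    have len: "length js = m" using affine_length_normal_form[OF f(1,2)] f(3) w(2) by simp
    have uniq: "js' = js \<and> kl' = kl"
      if "pairwise_ineqs n js'" "canonical_params n kl'" "w = affA_elt n (brick_word n js' @ canonical_word kl')"
      for js' kl'
      using normal_form_unique[OF that(1,2) f(1,2)] that(3) f(3) by simp
    show "(\<exists>!(js, x). affine_form n m w js x) \<and>
        (\<forall>js x. affine_form n m w js x \<longrightarrow>
           affA_reduced n (brick_word n js @ x) w \<and>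
           int (affA_length n w) =
             int (affA_length n (affA_elt n x)) +
             (\<Sum>s<m. int n + 1 + int (snd (js ! s)) + 1 - int (fst (js ! s)))) \<and>
        (\<exists>!(js, kl). length js = m \<and> pairwise_ineqs n js \<and> canonical_params n kl \<and>
           w = affA_elt n (brick_word n js @ canonical_word kl)) \<and>
        (\<forall>js kl. length js = m \<and> pairwise_ineqs n js \<and> canonical_params n kl \<and>
           w = affA_elt n (brick_word n js @ canonical_word kl) \<longrightarrow>
           affA_reduced n (brick_word n js @ canonical_word kl) w)"
    proof (intro conjI allI impI)
      show "\<exists>!(js, x). affine_form n m w js x"
      proof (rule ex1I)
        show "case (js, canonical_word kl) of (js, x) \<Rightarrow> affine_form n m w js x"
          unfolding prod.case affine_form_iff using f len by blast
      next
        fix p assume "case p of (js, x) \<Rightarrow> affine_form n m w js x"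
        then obtain js' x where p: "p = (js', x)" "affine_form n m w js' x" by (cases p) simp
        then obtain kl' where kl': "pairwise_ineqs n js'" "canonical_params n kl'" "x = canonical_word kl'"
          "w = affA_elt n (brick_word n js' @ x)"
          unfolding affine_form_iff by blast
        show "p = (js, canonical_word kl)"
          unfolding p(1) kl'(3) using uniq[OF kl'(1,2) kl'(4)[unfolded kl'(3)]] by (simp only:)
      qed
    next
      show "\<exists>!(js, kl). length js = m \<and> pairwise_ineqs n js \<and> canonical_params n kl \<and>
           w = affA_elt n (brick_word n js @ canonical_word kl)"
      proof (rule ex1I)
        show "case (js, kl) of (js, kl) \<Rightarrow> length js = m \<and> pairwise_ineqs n js \<and> canonical_params n kl \<and>
           w = affA_elt n (brick_word n js @ canonical_word kl)"
          unfolding prod.case by (intro conjI len f)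
      next
        fix p assume "case p of (js, kl) \<Rightarrow> length js = m \<and> pairwise_ineqs n js \<and> canonical_params n kl \<and>
           w = affA_elt n (brick_word n js @ canonical_word kl)"
        then show "p = (js, kl)" using uniq[of "fst p" "snd p"] by (cases p) (simp only: prod.case fst_conv snd_conv)
      qed
    next
      fix js' x assume "affine_form n m w js' x"
      then obtain kl' where F: "length js' = m" "pairwise_ineqs n js'" "canonical_params n kl'"
        "x = canonical_word kl'" "w = affA_elt n (brick_word n js' @ x)"
        unfolding affine_form_iff by blast
      show "affA_reduced n (brick_word n js' @ x) w"
        unfolding F(5) unfolding F(4) by (rule reduced[OF F(2,3)])
      show "int (affA_length n w) = int (affA_length n (affA_elt n x)) +
             (\<Sum>s<m. int n + 1 + int (snd (js' ! s)) + 1 - int (fst (js' ! s)))"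
        unfolding F(5) F(1)[symmetric] unfolding F(4) by (rule normal_form_length[OF F(2,3)])
    next
      fix js' kl'
      assume "length js' = m \<and> pairwise_ineqs n js' \<and> canonical_params n kl' \<and>
           w = affA_elt n (brick_word n js' @ canonical_word kl')"
      then show "affA_reduced n (brick_word n js' @ canonical_word kl') w"
        using reduced by simp
    qed
  qed
qed

end
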